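(* Suppose $f$ is convex and the smoothness assumption and the sampling assumption stated in the context hold. Let $\nu\ge\nu_{\max}$ be a constant. Let $\gamma_0=\frac1\nu$ and, for $k\ge0$, let $\gamma_{k+1}$ be the largest solution of $\gamma_{k+1}^2-\frac1\nu\gamma_{k+1}=\gamma_k^2$; let $\alpha_k=\frac{1}{\gamma_k\nu}\in(0,1]$ and $\beta_k=1$ for all $k\ge 0$. Then the sequences generated by the accelerated random sketch descent (A-RSD) algorithm with these parameters satisfy $$\mathbf{E}\big[f(x^k)-f^*\big]\;\le\;\frac{2\nu}{(k+1)^2}\,\min_{x^*\in X^*}\|x^0-x^*\|_{Z^\dagger}^2\qquad\forall k\ge1.$$
   Context: Problem: $f^*=\min_{x\in\mathbb{R}^n} f(x)$ subject to $Ax=b$ (the minimum is assumed attained), where $f:\mathbb{R}^n\to\mathbb{R}$ is differentiable, $A\in\mathbb{R}^{m\times n}$ with $m<n$ (the paper: $m\ll n$), and the feasible set is nonempty. $X^*$ is the set of feasible points $x^*$ with $\nabla f(x^* )\in\mathrm{range}(A^T)$; for convex $f$ it is the set of global minimizers. A point $x^0$ with $Ax^0=b$ is fixed; the feasible set is $x^0+\ker(A)$. Smoothness assumption: there is a symmetric positive semidefinite matrix $M\in\mathbb{R}^{n\times n}$, positive definite on $\ker(A)$ (i.e. $u^TMu>0$ for all nonzero $u\in\ker(A)$), such that $f(y)\le f(x)+\langle\nabla f(x),y-x\rangle+\tfrac12 (y-x)^TM(y-x)$ for all $x,y\in x^0+\ker(A)$. Sketching: $\mathcal{S}$ is a probability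 distribution on matrices $S\in\mathbb{R}^{n\times p}$ ($p$ may itself be random). $B^\dagger$ denotes the Moore–Penrose pseudo-inverse of $B$. Put $P_S=I_p-(AS)^\dagger(AS)$, $Z_S=SP_S(P_S^TS^TMSP_S)^\dagger P_S^TS^T\in\mathbb{R}^{n\times n}$, and $Z=\mathbf{E}_{S\sim\mathcal{S}}[Z_S]$. Sampling assumption: $Z_S$ has finite mean, and $Z$ is positive definite on $\ker(A)$. Notation: $\|u\|_Z=\sqrt{u^TZu}$, $\|u\|_{Z^\dagger}=\sqrt{u^TZ^\dagger u}$, and $\nu_{\max}=\max_{u\in\ker(A),\,u\ne0}\dfrac{\mathbf{E}_{S\sim\mathcal S}[\|Z_Su\|_{Z^\dagger}^2]}{\|u\|_Z^2}$. A-RSD algorithm (parameters: sequences $\alpha_k,\beta_k,\gamma_k$): start with the feasible $x^0$ and $v^0=x^0$; at each iteration $k\ge0$ sample $S\sim\mathcal{S}$ (independently of the past) and set $y^k=\alpha_kv^k+(1-\alpha_k)x^k$, $x^{k+1}=y^k-Z_S\nabla f(y^k)$, $v^{k+1}=\beta_kv^k+(1-\beta_k)y^k-\gamma_kZ_S\nabla f(y^k)$. $\mathbf{E}$ (without subscript) is the expectation over all sampled sketch matrices. *)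

theory Defs
  imports "HOL-Probability.Probability" "Jordan_Normal_Form.Matrix"
begin

no_notation scalar_prod (infix "\<bullet>" 70)
no_notation vec_index (infixl "$" 100)

(* A sketch matrix has n rows and a possibly random number of columns, so it is a matrix with
   explicit dimensions (type real mat).  Objects of fixed dimension have types real^'n and
   real^'n^'m.  The two functions below translate between the two kinds of matrices, identifying
   the index type 'n with {..<CARD('n)} through the library bijection to_nat_on UNIV. *)

definition to_mat :: "real^'n^'m \<Rightarrow> real mat" where
  "to_mat B = Matrix.mat CARD('m) CARD('n)
     (\<lambda>(i, j). B $ from_nat_into UNIV i $ from_nat_into UNIV j)"

definition from_mat :: "real mat \<Rightarrow> real^'n^'m" where
  "from_mat B = (\<chi> i j. B $$ (to_nat_on UNIV i, to_nat_on UNIV j))"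

(* The Moore-Penrose inverse: the unique matrix satisfying the four Penrose equations. *)

definition mp_inv_mat :: "real mat \<Rightarrow> real mat" where
  "mp_inv_mat B = (THE X. X \<in> carrier_mat (dim_col B) (dim_row B) \<and>
     B * X * B = B \<and> X * B * X = X \<and>
     transpose_mat (B * X) = B * X \<and> transpose_mat (X * B) = X * B)"

definition mp_inv :: "real^'n^'m \<Rightarrow> real^'m^'n" where
  "mp_inv B = (THE X. B ** X ** B = B \<and> X ** B ** X = X \<and>
     transpose (B ** X) = B ** X \<and> transpose (X ** B) = X ** B)"

definition null_space :: "real^'n^'m \<Rightarrow> (real^'n) set" where
  "null_space A = {u. A *v u = 0}"

definition pos_def_on :: "(real^'n) set \<Rightarrow> real^'n^'n \<Rightarrow> bool" where
  "pos_def_on V B \<longleftrightarrow> (\<forall>u\<in>V. u \<noteq> 0 \<longrightarrow> u \<bullet> (B *v u) > 0)"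

definition wnorm :: "real^'n^'n \<Rightarrow> real^'n \<Rightarrow> real" where
  "wnorm B u = sqrt (u \<bullet> (B *v u))"

(* P_S and Z_S for a sketch matrix S with CARD('n) rows and dim_col S columns. *)

definition sketch_P :: "real^'n^'m \<Rightarrow> real mat \<Rightarrow> real mat" where
  "sketch_P A S = 1\<^sub>m (dim_col S) - mp_inv_mat (to_mat A * S) * (to_mat A * S)"

definition sketch_Z :: "real^'n^'m \<Rightarrow> real^'n^'n \<Rightarrow> real mat \<Rightarrow> real^'n^'n" where
  "sketch_Z A M S = (let P = sketch_P A S in
     from_mat (S * P * mp_inv_mat (transpose_mat P * transpose_mat S * to_mat M * S * P)
       * transpose_mat P * transpose_mat S))"

(* The distribution of sketches is a probability measure D on real mat with an arbitrary
   sigma-algebra: integrability of sketch_Z A M, assumed wherever the mean is used, already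
   contains the measurability of Z_S. *)

definition sketch_mean :: "real^'n^'m \<Rightarrow> real^'n^'n \<Rightarrow> real mat measure \<Rightarrow> real^'n^'n" where
  "sketch_mean A M D = (\<integral>S. sketch_Z A M S \<partial>D)"

(* The expectation is a nonnegative integral and the result is extended real valued, because the
   second moment of Z_S may be infinite. *)

definition nu_max :: "real^'n^'m \<Rightarrow> real^'n^'n \<Rightarrow> real mat measure \<Rightarrow> ennreal" where
  "nu_max A M D = (let Z = sketch_mean A M D in
     SUP u \<in> {u \<in> null_space A. u \<noteq> 0}.
       (\<integral>\<^sup>+S. ennreal ((wnorm (mp_inv Z) (sketch_Z A M S *v u))\<^sup>2) \<partial>D)
         / ennreal ((wnorm Z u)\<^sup>2))"

definition feasible :: "real^'n^'m \<Rightarrow> real^'m \<Rightarrow> (real^'n) set" where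
  "feasible A b = {x. A *v x = b}"

definition opt_set :: "real^'n^'m \<Rightarrow> real^'m \<Rightarrow> (real^'n \<Rightarrow> real^'n) \<Rightarrow> (real^'n) set" where
  "opt_set A b g = {x \<in> feasible A b. g x \<in> range (\<lambda>w. transpose A *v w)}"

(* One run of A-RSD for fixed outcomes S 0, S 1, ... of the sampling, g being the gradient. *)

definition arsd_run ::
  "real^'n^'m \<Rightarrow> real^'n^'n \<Rightarrow> (real^'n \<Rightarrow> real^'n) \<Rightarrow> real^'n \<Rightarrow>
   (nat \<Rightarrow> real) \<Rightarrow> (nat \<Rightarrow> real) \<Rightarrow> (nat \<Rightarrow> real) \<Rightarrow> (nat \<Rightarrow> real mat) \<Rightarrow>
   (nat \<Rightarrow> real^'n) \<Rightarrow> (nat \<Rightarrow> real^'n) \<Rightarrow> (nat \<Rightarrow> real^'n) \<Rightarrow> bool" where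
  "arsd_run A M g x0 \<alpha> \<beta> \<gamma> S x y v \<longleftrightarrow> x 0 = x0 \<and> v 0 = x0 \<and>
     (\<forall>k. y k = \<alpha> k *\<^sub>R v k + (1 - \<alpha> k) *\<^sub>R x k \<and>
          x (Suc k) = y k - sketch_Z A M (S k) *v g (y k) \<and>
          v (Suc k) = \<beta> k *\<^sub>R v k + (1 - \<beta> k) *\<^sub>R y k
                        - \<gamma> k *\<^sub>R (sketch_Z A M (S k) *v g (y k)))"

end

theory Submission
  imports Defs "Jordan_Normal_Form.Gauss_Jordan_Elimination"
begin

text \<open>
  Why the rate holds. Three facts make \<open>Z_S\<close> a good preconditioner: it is symmetric, its range lies
  in \<open>ker A\<close>, and \<open>Z_S M Z_S = Z_S\<close>. The second keeps all iterates feasible. The third turns the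
  smoothness bound at \<open>x' = y - Z_S g\<close>, with \<open>g\<close> the gradient of \<open>f\<close> at \<open>y\<close>, into the descent
  \<open>f x' \<le> f y - 1/2 \<langle>g, Z_S g\<rangle>\<close>. Taking means, one step decreases \<open>f\<close> by at least
  \<open>1/2 \<langle>g, Z g\<rangle>\<close>, while the definition of \<open>\<nu>\<^sub>max\<close> bounds the second moment
  \<open>E \<parallel>Z_S g\<parallel>\<^sup>2 \<le> \<nu> \<langle>g, Z g\<rangle>\<close> in the norm of \<open>Z\<^sup>\<dagger>\<close>. This norm is the right one to measure
  \<open>v - x*\<close>: since \<open>Z\<^sup>\<dagger> Z\<close> is the orthogonal projection onto \<open>ker A\<close>, the mean cross term
  \<open>\<langle>Z g, Z\<^sup>\<dagger> (v - x*)\<rangle>\<close> is just \<open>\<langle>g, v - x*\<rangle>\<close>, to which convexity applies.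

  Write \<open>r\<^sub>k\<close> for the \<open>Z\<^sup>\<dagger>\<close>-norm of \<open>v\<^sup>k - x*\<close>. Because \<open>\<alpha> = 1 / (\<gamma> \<nu>)\<close>, all terms in \<open>f y\<close> and all
  terms in \<open>\<langle>g, Z g\<rangle>\<close> cancel, which leaves
  \<open>E [r\<^sub>k\<^sub>+\<^sub>1\<^sup>2 + 2 \<gamma>\<^sup>2 \<nu> (f x\<^sup>k\<^sup>+\<^sup>1 - f x*)] \<le> r\<^sub>k\<^sup>2 + 2 (\<gamma>\<^sup>2 \<nu> - \<gamma>) (f x\<^sup>k - f x*)\<close> for \<open>\<gamma> = \<gamma>\<^sub>k\<close>
  (lemma \<open>expected_lyapunov_step\<close>). The recursion for \<open>\<gamma>\<close> says exactly that the coefficient on the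
  right equals the one produced on the left by the previous step, so the bounds telescope
  (lemma \<open>expected_lyapunov\<close>) to \<open>2 \<gamma>\<^sub>k\<^sub>-\<^sub>1\<^sup>2 \<nu> E [f x\<^sup>k - f x*] \<le> r\<^sub>0\<^sup>2\<close>. The recursion also gives
  \<open>\<gamma>\<^sub>k\<^sub>+\<^sub>1 \<ge> \<gamma>\<^sub>k + 1 / (2 \<nu>)\<close>, hence \<open>\<gamma>\<^sub>k\<^sub>-\<^sub>1 \<ge> (k + 1) / (2 \<nu>)\<close>, and the rate follows.

  Integrability of the iterates is not known beforehand, so the telescoping is done with nonnegative
  integrals over the finite product of the sketch distribution; independence identifies this product
  with the law of the first \<open>k\<close> samples. The pseudo-inverses are defined by a definite description, so
  their existence and uniqueness are proved first; existence rests on reduced row echelon forms.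
\<close>

(* Throughout, \<bullet> is the inner product and $ selects components of real^'n. *)
no_notation scalar_prod (infix "\<bullet>" 70)
no_notation vec_index (infixl "$" 100)

section \<open>Existence and uniqueness of the Moore-Penrose inverse\<close>

text \<open>Dimension equations as side conditions, unlike carrier memberships, are discharged by
  simplification, so chains of products of mixed sizes can be normalised automatically.\<close>
lemma mult_assoc_dims:
  fixes A B C :: "real mat"
  shows "dim_col A = dim_row B \<Longrightarrow> dim_col B = dim_row C \<Longrightarrow> A * B * C = A * (B * C)"
  by (rule assoc_mult_mat[of _ "dim_row A" "dim_row B" _ "dim_row C" _ "dim_col C"]) auto

lemma transpose_mult_dims:
  fixes A B :: "real mat"
  shows "dim_col A = dim_row B \<Longrightarrow> transpose_mat (A * B) = transpose_mat B * transpose_mat A"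
  by (rule transpose_mult[of _ "dim_row A" "dim_row B" _ "dim_col B"]) auto

text \<open>If \<open>C = U B\<close> is the reduced row echelon form of \<open>B\<close>, let \<open>G\<close> send the \<open>i\<close>-th unit
  vector to the unit vector of the pivot column of row \<open>i\<close>, and to zero if row \<open>i\<close> has no
  pivot. Pivot columns of \<open>C\<close> are unit vectors and rows without pivot vanish, so \<open>C G\<close> is a
  coordinate projection that fixes \<open>C\<close>, and \<open>G U\<close> is a generalised inverse of \<open>B\<close>.\<close>
lemma generalized_inverse_exists:
  fixes B :: "real mat"
  assumes B: "B \<in> carrier_mat m n"
  shows "\<exists>G\<in>carrier_mat n m. B * G * B = B"
proof -
  obtain C where gj: "gauss_jordan_single B = C" by blast
  have C: "C \<in> carrier_mat m n" using gauss_jordan_single(2)[OF B gj] .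
  obtain U V where U: "C = U * B" "U \<in> carrier_mat m m" "V \<in> carrier_mat m m" "V * U = 1\<^sub>m m"
    using gauss_jordan_single(4)[OF B gj] by blast
  obtain p where "pivot_fun C p (dim_col C)"
    using gauss_jordan_single(3)[OF B gj] unfolding row_echelon_form_def by blast
  then have pf: "pivot_fun C p n" using C by simp
  have dC: "dim_row C = m" "dim_col C = n" using C by auto
  note piv = pivot_funD[OF dC(1) pf]
  (* p i = n marks a row without pivot; then no j equals p i and column i of G is zero. *)
  define G where "G = Matrix.mat n m (\<lambda>(j, i). if j = p i then 1 else (0::real))"
  have G: "G \<in> carrier_mat n m" by (simp add: G_def)
  have CG: "(C * G) $$ (i, k) = (if i = k \<and> p i < n then 1 else 0)" if "i < m" "k < m" for i k
  proof -
    have "(C * G) $$ (i, k) = (\<Sum>j\<in>{0..<n}. C $$ (i, j) * (if j = p k then 1 else 0))"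
      using that dC by (simp add: scalar_prod_def G_def)
    also have "\<dots> = (if p k < n then C $$ (i, p k) else 0)"
      by (simp add: if_distrib[of "\<lambda>x. _ * x"] sum.delta cong: if_cong)
    also have "\<dots> = (if i = k \<and> p i < n then 1 else 0)"
      using piv(4)[of i] piv(5)[of k i] that by auto
    finally show ?thesis .
  qed
  have CGC: "C * G * C = C"
  proof (rule eq_matI)
    show "dim_row (C * G * C) = dim_row C" "dim_col (C * G * C) = dim_col C" using dC by auto
    fix i j assume ij: "i < dim_row C" "j < dim_col C"
    have dCG: "dim_row (C * G) = m" "dim_col (C * G) = m" using dC G by auto
    have "(C * G * C) $$ (i, j) = (\<Sum>k\<in>{0..<m}. (C * G) $$ (i, k) * C $$ (k, j))"
      using ij dC dCG by (simp add: scalar_prod_def del: index_mult_mat(1) assoc_mult_mat)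
        (simp add: index_mult_mat(1) scalar_prod_def)
    also have "\<dots> = (\<Sum>k\<in>{0..<m}. (if k = i then (if p i < n then C $$ (i, j) else 0) else 0))"
      using ij dC by (intro sum.cong) (auto simp del: index_mult_mat(1) simp: CG)
    also have "\<dots> = (if p i < n then C $$ (i, j) else 0)" using ij dC by (simp add: sum.delta)
    also have "\<dots> = C $$ (i, j)"
      using piv(1)[of i] piv(2)[of i j] ij dC by (auto simp: not_less)
    finally show "(C * G * C) $$ (i, j) = C $$ (i, j)" .
  qed
  have dU: "dim_row U = m" "dim_col U = m" "dim_row V = m" "dim_col V = m" "dim_row B = m"
      "dim_col B = n" "dim_row G = n" "dim_col G = m" using U B G by auto
  have VC: "V * C = B"
  proof -
    have "V * C = V * U * B" using dU U(1) by (simp add: mult_assoc_dims)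
    then show ?thesis using U(4) B by simp
  qed
  have "B * (G * U) * B = V * C * (G * U) * B" using VC by simp
  also have "\<dots> = V * (C * G * (U * B))" using dU dC by (simp add: mult_assoc_dims)
  also have "\<dots> = B" using CGC U(1) VC by simp
  finally show ?thesis using G U(2) by (intro bexI[of _ "G * U"]) auto
qed

lemma gram_eq_zero:
  fixes X :: "real mat"
  assumes "transpose_mat X * X = 0\<^sub>m (dim_col X) (dim_col X)"
  shows "X = 0\<^sub>m (dim_row X) (dim_col X)"
proof (rule eq_matI)
  fix i j assume "i < dim_row (0\<^sub>m (dim_row X) (dim_col X) :: real mat)"
    "j < dim_col (0\<^sub>m (dim_row X) (dim_col X) :: real mat)"
  then have ij: "i < dim_row X" "j < dim_col X" by auto
  have "(\<Sum>k\<in>{0..<dim_row X}. X $$ (k, j) * X $$ (k, j)) = (transpose_mat X * X) $$ (j, j)"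
    using ij by (simp add: scalar_prod_def)
  also have "\<dots> = 0" using assms ij by simp
  finally have "X $$ (i, j) * X $$ (i, j) = 0"
    using ij by (subst (asm) sum_nonneg_eq_0_iff) auto
  then show "X $$ (i, j) = 0\<^sub>m (dim_row X) (dim_col X) $$ (i, j)" using ij by simp
qed auto

text \<open>Take \<open>L = G B\<^sup>T\<close> with \<open>G\<close> a generalised inverse of the Gram matrix \<open>B\<^sup>T B\<close>, and let
  \<open>Q = B L\<close>. The defect \<open>E = Q B - B\<close> has the form \<open>B K\<close> and satisfies \<open>B\<^sup>T E = 0\<close>, so
  \<open>E\<^sup>T E = 0\<close> and \<open>E = 0\<close>. Then \<open>Q Q\<^sup>T = Q\<^sup>T\<close>, and \<open>Q\<close> is symmetric because the left side
  is.\<close>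
lemma least_squares_inverse_exists:
  fixes B :: "real mat"
  assumes B: "B \<in> carrier_mat m n"
  shows "\<exists>L\<in>carrier_mat n m. B * L * B = B \<and> transpose_mat (B * L) = B * L"
proof -
  let ?T = "transpose_mat B"
  obtain G where G: "G \<in> carrier_mat n n" and g: "?T * B * G * (?T * B) = ?T * B"
    using generalized_inverse_exists[of "?T * B" n n] B by auto
  have d: "dim_row B = m" "dim_col B = n" "dim_row G = n" "dim_col G = n" using B G by auto
  note sm = mult_assoc_dims transpose_mult_dims d
  define Q where "Q = B * (G * ?T)"
  have dQ: "dim_row Q = m" "dim_col Q = m" by (auto simp: Q_def d)
  define E where "E = Q * B - B"
  have dE: "dim_row E = m" "dim_col E = n" by (auto simp: E_def d)
  have TE: "?T * E = 0\<^sub>m n n"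
  proof -
    have "?T * E = ?T * (Q * B) - ?T * B" unfolding E_def
      by (rule mult_minus_distrib_mat[of _ n m _ n]) (auto simp: d dQ)
    also have "?T * (Q * B) = ?T * B" using g by (simp add: Q_def sm)
    finally show ?thesis by (intro eq_matI) (auto simp: d)
  qed
  have E_fact: "E = B * (G * ?T * B - 1\<^sub>m n)"
  proof -
    have "B * (G * ?T * B - 1\<^sub>m n) = B * (G * ?T * B) - B * 1\<^sub>m n"
      by (rule mult_minus_distrib_mat[of _ m n _ n]) (auto simp: d)
    then show ?thesis by (simp add: E_def Q_def sm right_mult_one_mat[OF B])
  qed
  have "transpose_mat E * E = transpose_mat (G * ?T * B - 1\<^sub>m n) * (?T * E)"
    by (subst E_fact, subst transpose_mult_dims) (auto simp: d dE mult_assoc_dims)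
  also have "\<dots> = 0\<^sub>m n n" unfolding TE by (rule right_mult_zero_mat[of _ n n]) (auto simp: d)
  finally have "E = 0\<^sub>m m n" using gram_eq_zero[of E] dE by simp
  then have QB: "Q * B = B"
  proof -
    have eq0: "Q * B - B = 0\<^sub>m m n" using \<open>E = 0\<^sub>m m n\<close> E_def by simp
    show ?thesis
    proof (rule eq_matI)
      fix i j assume ij: "i < dim_row B" "j < dim_col B"
      then have "(Q * B - B) $$ (i, j) = 0" using eq0 d by simp
      moreover have "(Q * B - B) $$ (i, j) = (Q * B) $$ (i, j) - B $$ (i, j)"
        using ij by (simp add: minus_mat_def)
      ultimately show "(Q * B) $$ (i, j) = B $$ (i, j)" by simp
    qed (auto simp: d dQ)
  qed
  have QQ: "Q * transpose_mat Q = transpose_mat Q"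
  proof -
    have "transpose_mat Q = B * (transpose_mat G * ?T)" by (simp add: Q_def sm)
    then have "Q * transpose_mat Q = Q * B * (transpose_mat G * ?T)" by (simp add: mult_assoc_dims d dQ)
    then show ?thesis using QB \<open>transpose_mat Q = _\<close> by simp
  qed
  have "transpose_mat (Q * transpose_mat Q) = Q * transpose_mat Q"
    by (simp add: transpose_mult_dims dQ)
  then have "transpose_mat Q = Q" using QQ by simp
  then show ?thesis using QB Q_def G B by (intro bexI[of _ "G * ?T"]) auto
qed

text \<open>A least-squares inverse \<open>L\<close> of \<open>B\<close> makes \<open>B L\<close> symmetric; the transpose \<open>R\<close> of one of
  \<open>B\<^sup>T\<close> makes \<open>R B\<close> symmetric. The product \<open>X = R B L\<close> inherits both, since \<open>B X = B L\<close> and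
  \<open>X B = R B\<close>.\<close>
lemma penrose_exists:
  fixes B :: "real mat"
  shows "\<exists>X. X \<in> carrier_mat (dim_col B) (dim_row B) \<and> B * X * B = B \<and> X * B * X = X \<and>
     transpose_mat (B * X) = B * X \<and> transpose_mat (X * B) = X * B"
proof -
  define m n where "m = dim_row B" and "n = dim_col B"
  have B: "B \<in> carrier_mat m n" "transpose_mat B \<in> carrier_mat n m" by (auto simp: m_def n_def)
  obtain L where L: "L \<in> carrier_mat n m" "B * L * B = B" "transpose_mat (B * L) = B * L"
    using least_squares_inverse_exists[OF B(1)] by blast
  obtain R' where R': "R' \<in> carrier_mat m n" "transpose_mat B * R' * transpose_mat B = transpose_mat B"
     "transpose_mat (transpose_mat B * R') = transpose_mat B * R'"
    using least_squares_inverse_exists[OF B(2)] by blast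
  define R where "R = transpose_mat R'"
  have d: "dim_row L = n" "dim_col L = m" "dim_row R = n" "dim_col R = m" "dim_row R' = m"
    "dim_col R' = n" "dim_row B = m" "dim_col B = n" using L R' B by (auto simp: R_def)
  have L1: "B * (L * B) = B" using L(2) d by (simp add: mult_assoc_dims)
  have L2: "B * (L * (B * Y)) = B * Y" if "dim_row Y = n" for Y
    using arg_cong[OF L(2), of "\<lambda>T. T * Y"] d that by (simp add: mult_assoc_dims)
  have R1: "B * (R * B) = B"
    using arg_cong[OF R'(2), of transpose_mat] d by (simp add: mult_assoc_dims transpose_mult_dims R_def)
  have R2: "B * (R * (B * Y)) = B * Y" if "dim_row Y = n" for Y
    using arg_cong[OF R1, of "\<lambda>T. T * Y"] d that by (simp add: mult_assoc_dims)
  have RB: "transpose_mat (R * B) = R * B"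
    using R'(3) d by (simp add: transpose_mult_dims R_def)
  define X where "X = R * (B * L)"
  have BX: "B * X = B * L" using R2[of L] d by (simp add: X_def)
  have XB: "X * B = R * B" using L1 d by (simp add: X_def mult_assoc_dims)
  have "X * B * X = X"
    unfolding XB by (simp add: X_def mult_assoc_dims d R2)
  moreover have "B * X * B = B" unfolding BX using L(2) .
  moreover have "X \<in> carrier_mat (dim_col B) (dim_row B)"
    unfolding X_def using d by (intro carrier_matI) simp_all
  moreover have "transpose_mat (B * X) = B * X" unfolding BX by (rule L(3))
  moreover have "transpose_mat (X * B) = X * B" unfolding XB by (rule RB)
  ultimately show ?thesis by blast
qed

text \<open>By symmetry, \<open>B X = (B Y B X)\<^sup>T = B X B Y = B Y\<close>, and likewise \<open>X B = Y B\<close>; hence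
  \<open>X = X B X = X B Y = Y B Y = Y\<close>.\<close>
lemma penrose_unique:
  fixes B X Y :: "real mat"
  assumes X: "X \<in> carrier_mat (dim_col B) (dim_row B)" "B * X * B = B" "X * B * X = X"
     "transpose_mat (B * X) = B * X" "transpose_mat (X * B) = X * B"
    and Y: "Y \<in> carrier_mat (dim_col B) (dim_row B)" "B * Y * B = B" "Y * B * Y = Y"
     "transpose_mat (B * Y) = B * Y" "transpose_mat (Y * B) = Y * B"
  shows "X = Y"
proof -
  have d: "dim_row X = dim_col B" "dim_col X = dim_row B" "dim_row Y = dim_col B" "dim_col Y = dim_row B"
    using X Y by auto
  have 1: "B * X = B * Y"
  proof -
    have "B * X = transpose_mat (B * Y * B * X)" using Y(2) X(4) by simp
    also have "\<dots> = transpose_mat (B * X) * transpose_mat (B * Y)"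
      using d by (simp add: mult_assoc_dims transpose_mult_dims)
    also have "\<dots> = B * X * B * Y" unfolding X(4) Y(4) using d by (simp add: mult_assoc_dims)
    also have "\<dots> = B * Y" using X(2) by simp
    finally show ?thesis .
  qed
  have 2: "X * B = Y * B"
  proof -
    have "X * B = transpose_mat (X * (B * Y * B))" using Y(2) X(5) by simp
    also have "\<dots> = transpose_mat (Y * B) * transpose_mat (X * B)"
      using d by (simp add: mult_assoc_dims transpose_mult_dims)
    also have "\<dots> = Y * (B * X * B)" unfolding X(5) Y(5) using d by (simp add: mult_assoc_dims)
    also have "\<dots> = Y * B" using X(2) by simp
    finally show ?thesis .
  qed
  have "X = X * (B * X)" using X(3) d by (simp add: mult_assoc_dims)
  also have "\<dots> = X * B * Y" using 1 d by (simp add: mult_assoc_dims)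
  also have "\<dots> = Y" using 2 Y(3) by simp
  finally show ?thesis .
qed

lemma mp_inv_mat_penrose:
  fixes B :: "real mat"
  shows "mp_inv_mat B \<in> carrier_mat (dim_col B) (dim_row B)"
    "B * mp_inv_mat B * B = B" "mp_inv_mat B * B * mp_inv_mat B = mp_inv_mat B"
    "transpose_mat (B * mp_inv_mat B) = B * mp_inv_mat B"
    "transpose_mat (mp_inv_mat B * B) = mp_inv_mat B * B"
proof -
  have "\<exists>!X. X \<in> carrier_mat (dim_col B) (dim_row B) \<and> B * X * B = B \<and> X * B * X = X \<and>
     transpose_mat (B * X) = B * X \<and> transpose_mat (X * B) = X * B"
    by (rule ex_ex1I[OF penrose_exists], elim conjE, rule penrose_unique) assumption+
  from theI'[OF this, folded mp_inv_mat_def]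
  show "mp_inv_mat B \<in> carrier_mat (dim_col B) (dim_row B)"
    "B * mp_inv_mat B * B = B" "mp_inv_mat B * B * mp_inv_mat B = mp_inv_mat B"
    "transpose_mat (B * mp_inv_mat B) = B * mp_inv_mat B"
    "transpose_mat (mp_inv_mat B * B) = mp_inv_mat B * B" by blast+
qed

text \<open>Transposing the Penrose equations of a symmetric \<open>B\<close> shows that the transposed inverse
  solves them as well, so uniqueness applies.\<close>
lemma mp_inv_mat_symmetric:
  fixes B :: "real mat"
  assumes "transpose_mat B = B"
  shows "transpose_mat (mp_inv_mat B) = mp_inv_mat B"
proof -
  let ?X = "mp_inv_mat B"
  note p = mp_inv_mat_penrose[of B]
  have sq: "dim_row B = dim_col B" using arg_cong[OF assms, of dim_row] by simp
  have d: "dim_row ?X = dim_col B" "dim_col ?X = dim_col B" using p(1) sq by auto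
  have t: "B * transpose_mat ?X = transpose_mat (?X * B)" "transpose_mat ?X * B = transpose_mat (B * ?X)"
    using assms d sq by (simp_all add: transpose_mult_dims)
  have a: "B * transpose_mat ?X * B = B" "transpose_mat ?X * B * transpose_mat ?X = transpose_mat ?X"
    using arg_cong[OF p(2), of transpose_mat] arg_cong[OF p(3), of transpose_mat] assms d sq
    by (simp_all add: transpose_mult_dims mult_assoc_dims)
  show ?thesis
  proof (rule penrose_unique[OF _ a _ _ p])
    show "transpose_mat ?X \<in> carrier_mat (dim_col B) (dim_row B)" using d sq by auto
    show "transpose_mat (B * transpose_mat ?X) = B * transpose_mat ?X"
      unfolding t(1) by (simp only: p(5))
    show "transpose_mat (transpose_mat ?X * B) = transpose_mat ?X * B"
      unfolding t(2) by (simp only: p(4))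
  qed
qed

section \<open>Transfer between matrices of fixed and of explicit dimension\<close>

lemma to_nat_on_UNIV_less: "to_nat_on UNIV (i::'n::finite) < CARD('n)"
  using to_nat_on_finite[of "UNIV :: 'n set"] by (auto simp: bij_betw_def)

lemma to_nat_on_from_nat_into_UNIV:
  "k < CARD('n) \<Longrightarrow> to_nat_on UNIV (from_nat_into UNIV k :: 'n::finite) = k"
  by (rule to_nat_on_from_nat_into)
    (use to_nat_on_finite[of "UNIV :: 'n set"] in \<open>auto simp: bij_betw_def\<close>)

lemma sum_UNIV_from_nat_into:
  "sum h (UNIV :: 'n::finite set) = (\<Sum>k\<in>{0..<CARD('n)}. h (from_nat_into UNIV k))"
  using sum.reindex_bij_betw[OF bij_betw_from_nat_into_finite[OF finite], of h]
  by (simp add: atLeast0LessThan)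

lemma to_mat_dims [simp]:
  fixes B :: "real^'n^'m"
  shows "dim_row (to_mat B) = CARD('m)" "dim_col (to_mat B) = CARD('n)"
  by (simp_all add: to_mat_def)

lemma from_mat_to_mat: "from_mat (to_mat B) = (B :: real^'n^'m)"
  by (simp add: to_mat_def from_mat_def to_nat_on_UNIV_less Finite_Cartesian_Product.vec_eq_iff)

lemma to_mat_from_mat:
  assumes "X \<in> carrier_mat CARD('m) CARD('n)"
  shows "to_mat (from_mat X :: real^'n^'m) = X"
  using assms by (intro eq_matI) (auto simp: to_mat_def from_mat_def to_nat_on_from_nat_into_UNIV)

lemma to_mat_eq_iff: "to_mat B = to_mat C \<longleftrightarrow> B = (C :: real^'n^'m)"
  by (metis from_mat_to_mat)

lemma to_mat_mult:
  fixes B :: "real^'k^'m" and C :: "real^'n^'k"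
  shows "to_mat (B ** C) = to_mat B * to_mat C"
  by (intro eq_matI)
    (auto simp: to_mat_def matrix_matrix_mult_def scalar_prod_def sum_UNIV_from_nat_into)

lemma to_mat_transpose: "to_mat (Finite_Cartesian_Product.transpose (B :: real^'n^'m)) = transpose_mat (to_mat B)"
  by (intro eq_matI) (auto simp: to_mat_def Finite_Cartesian_Product.transpose_def)

lemma to_mat_zero: "to_mat (0 :: real^'n^'m) = 0\<^sub>m CARD('m) CARD('n)"
  by (intro eq_matI) (auto simp: to_mat_def)

text \<open>Both inverses are described by the same equations, and \<open>to_mat\<close> is an injective
  homomorphism for products and transposes, so everything known about the first kind carries
  over to the second.\<close>
lemma mp_inv_eq_mp_inv_mat:
  fixes B :: "real^'n^'m"
  shows "mp_inv B = from_mat (mp_inv_mat (to_mat B))" and "to_mat (mp_inv B) = mp_inv_mat (to_mat B)"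
proof -
  let ?X = "from_mat (mp_inv_mat (to_mat B)) :: real^'m^'n"
  note p = mp_inv_mat_penrose[of "to_mat B"]
  have X: "to_mat ?X = mp_inv_mat (to_mat B)"
    by (rule to_mat_from_mat) (use p(1) in simp)
  show "mp_inv B = ?X" unfolding mp_inv_def
  proof (rule the_equality)
    show "B ** ?X ** B = B \<and> ?X ** B ** ?X = ?X \<and>
       transpose (B ** ?X) = B ** ?X \<and> transpose (?X ** B) = ?X ** B"
      unfolding to_mat_eq_iff[symmetric] to_mat_mult to_mat_transpose X using p by blast
    fix Y :: "real^'m^'n"
    assume "B ** Y ** B = B \<and> Y ** B ** Y = Y \<and>
       transpose (B ** Y) = B ** Y \<and> transpose (Y ** B) = Y ** B"
    then have *: "to_mat B * to_mat Y * to_mat B = to_mat B" "to_mat Y * to_mat B * to_mat Y = to_mat Y"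
       "transpose_mat (to_mat B * to_mat Y) = to_mat B * to_mat Y"
       "transpose_mat (to_mat Y * to_mat B) = to_mat Y * to_mat B"
      by (simp_all only: to_mat_mult[symmetric] to_mat_transpose[symmetric])
    have "to_mat Y = mp_inv_mat (to_mat B)"
      by (rule penrose_unique[OF _ * p]) (intro carrier_matI; simp)
    then show "Y = ?X" using X to_mat_eq_iff by metis
  qed
  then show "to_mat (mp_inv B) = mp_inv_mat (to_mat B)" using X by simp
qed

lemma mp_inv_penrose:
  fixes B :: "real^'n^'m"
  shows "B ** mp_inv B ** B = B" "mp_inv B ** B ** mp_inv B = mp_inv B"
    "transpose (B ** mp_inv B) = B ** mp_inv B" "transpose (mp_inv B ** B) = mp_inv B ** B"
  unfolding to_mat_eq_iff[symmetric] to_mat_mult to_mat_transpose mp_inv_eq_mp_inv_mat(2)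
  by (rule mp_inv_mat_penrose)+

lemma mp_inv_symmetric:
  fixes B :: "real^'n^'n"
  assumes "transpose B = B"
  shows "transpose (mp_inv B) = mp_inv B"
  using mp_inv_mat_symmetric[of "to_mat B"] assms
  unfolding to_mat_eq_iff[symmetric] to_mat_transpose mp_inv_eq_mp_inv_mat(2) by simp

section \<open>Orthogonality to a null space\<close>

lemma symmetric_inner:
  fixes B :: "real^'n^'n"
  assumes "transpose B = B"
  shows "(B *v u) \<bullet> w = u \<bullet> (B *v w)"
  by (metis assms dot_lmul_matrix transpose_matrix_vector)

lemma subspace_null_space: "subspace (null_space A)"
  by (auto simp: subspace_def null_space_def matrix_vector_right_distrib matrix_vector_mult_scaleR)

lemma null_space_decomp:
  obtains p q where "u = p + q" "p \<in> null_space A" "\<And>w. w \<in> null_space A \<Longrightarrow> w \<bullet> q = 0"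
proof -
  have sp: "span (null_space A) = null_space A" using subspace_null_space by (simp add: span_eq_iff)
  obtain p q where "p \<in> span (null_space A)" "\<And>w. w \<in> span (null_space A) \<Longrightarrow> Linear_Algebra.orthogonal q w"
    "u = p + q"
    using orthogonal_subspace_decomp_exists by blast
  then show ?thesis using that[of p q] sp by (auto simp: Linear_Algebra.orthogonal_def inner_commute)
qed

text \<open>The component \<open>q\<close> of \<open>g\<close> orthogonal to the row space lies in the null space, so \<open>q\<close> is
  orthogonal to \<open>g\<close> and hence to itself.\<close>
lemma orthogonal_null_space_imp_in_row_space:
  fixes A :: "real^'n^'m"
  assumes "\<And>w. w \<in> null_space A \<Longrightarrow> w \<bullet> g = 0"
  shows "g \<in> range (\<lambda>w. transpose A *v w)"
proof -
  let ?R = "range (\<lambda>w. transpose A *v w)"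
  have sp: "span ?R = ?R"
    by (simp add: span_eq_iff linear_subspace_image del: transpose_matrix_vector)
  obtain p q where pq: "p \<in> ?R" "\<And>w. w \<in> ?R \<Longrightarrow> Linear_Algebra.orthogonal q w" "g = p + q"
    using orthogonal_subspace_decomp_exists[where S = ?R] unfolding sp by blast
  have "(A *v q) \<bullet> (A *v q) = 0"
    using pq(2)[of "transpose A *v (A *v q)"]
    by (simp add: Linear_Algebra.orthogonal_def dot_lmul_matrix inner_commute[of q])
  then have "q \<in> null_space A" by (simp add: null_space_def)
  then have "q \<bullet> g = 0" using assms by blast
  moreover have "q \<bullet> p = 0" using pq(1,2) by (simp add: Linear_Algebra.orthogonal_def)
  ultimately have "q = 0" using pq(3) by (simp add: inner_add_right)
  then show ?thesis using pq by simp
qed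

lemma bounded_linear_apply_left: "bounded_linear (\<lambda>B :: real^'n^'m. B *v u)"
  by (intro linear_conv_bounded_linear[THEN iffD1] linearI)
    (simp_all add: matrix_vector_mult_add_rdistrib scaleR_matrix_vector_assoc)

lemma bounded_linear_transpose: "bounded_linear (transpose :: real^'n^'m \<Rightarrow> real^'m^'n)"
  by (intro linear_conv_bounded_linear[THEN iffD1] linearI)
    (simp_all add: Finite_Cartesian_Product.transpose_def Finite_Cartesian_Product.vec_eq_iff)

section \<open>Sketched preconditioners and their mean\<close>

text \<open>The three properties of \<open>Z_S\<close> on which the method rests: steps stay in the feasible
  set, \<open>Z_S\<close> is symmetric, and \<open>Z_S\<close> inverts \<open>M\<close> on its range. They come from \<open>A S P_S = 0\<close>,
  from the symmetry of \<open>W = P_S\<^sup>T S\<^sup>T M S P_S\<close>, and from \<open>W\<^sup>\<dagger> W W\<^sup>\<dagger> = W\<^sup>\<dagger>\<close>.\<close>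
lemma sketch_Z_algebra:
  fixes A :: "real^'n^'m" and M :: "real^'n^'n"
  assumes S: "dim_row S = CARD('n)" and M: "transpose M = M"
  shows "A ** sketch_Z A M S = 0" "transpose (sketch_Z A M S) = sketch_Z A M S"
    "sketch_Z A M S ** M ** sketch_Z A M S = sketch_Z A M S"
proof -
  define p where "p = dim_col S"
  define a where "a = to_mat A * S"
  define N where "N = to_mat M"
  define Q where "Q = sketch_P A S"
  define W where "W = transpose_mat Q * transpose_mat S * N * S * Q"
  define V where "V = mp_inv_mat W"
  define T where "T = S * Q * V * transpose_mat Q * transpose_mat S"
  note pa = mp_inv_mat_penrose[of a] and pw = mp_inv_mat_penrose[of W]
  have da: "dim_row a = CARD('m)" "dim_col a = p" by (auto simp: a_def p_def)
  have dX: "dim_row (mp_inv_mat a) = p" "dim_col (mp_inv_mat a) = CARD('m)" using pa(1) da by auto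
  have Q: "Q = 1\<^sub>m p - mp_inv_mat a * a" by (simp add: Q_def sketch_P_def a_def p_def)
  have d: "dim_row S = CARD('n)" "dim_col S = p" "dim_row Q = p" "dim_col Q = p"
      "dim_row N = CARD('n)" "dim_col N = CARD('n)"
    using S da dX by (auto simp: Q p_def N_def)
  have dW: "dim_row W = p" "dim_col W = p" by (auto simp: W_def d)
  have dV: "dim_row V = p" "dim_col V = p" using pw(1) dW by (auto simp: V_def)
  have dT: "dim_row T = CARD('n)" "dim_col T = CARD('n)" by (auto simp: T_def d)
  note sm = mult_assoc_dims transpose_mult_dims d dW dV dT da
  have Nsym: "transpose_mat N = N" by (simp add: N_def to_mat_transpose[symmetric] M)
  have aQ: "a * Q = 0\<^sub>m CARD('m) p"
  proof -
    have "a * Q = a * 1\<^sub>m p - a * (mp_inv_mat a * a)" unfolding Q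
      by (rule mult_minus_distrib_mat[of _ "CARD('m)" p _ p]) (auto simp: da dX)
    also have "a * 1\<^sub>m p = a" by (rule right_mult_one_mat[of _ "CARD('m)"]) (auto simp: da)
    also have "a * (mp_inv_mat a * a) = a" using pa(2) da dX by (simp add: mult_assoc_dims)
    finally show ?thesis by (intro eq_matI) (auto simp: da)
  qed
  have AT: "to_mat A * T = 0\<^sub>m CARD('m) CARD('n)"
  proof -
    have "to_mat A * T = a * Q * (V * (transpose_mat Q * transpose_mat S))"
      by (simp add: T_def a_def sm)
    then show ?thesis unfolding aQ
      by (simp add: left_mult_zero_mat[of _ p "CARD('n)"] carrier_matI d dV)
  qed
  have "transpose_mat W = W" by (simp add: W_def sm Nsym)
  then have Vsym: "transpose_mat V = V" unfolding V_def by (rule mp_inv_mat_symmetric)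
  have Tsym: "transpose_mat T = T" by (simp add: T_def sm Vsym)
  have "T * N * T = S * Q * (V * W * V) * transpose_mat Q * transpose_mat S"
    by (simp add: T_def W_def sm)
  then have TNT: "T * N * T = T" using pw(3) by (simp add: T_def V_def)
  have Z: "to_mat (sketch_Z A M S) = T"
  proof -
    have "sketch_Z A M S = from_mat T"
      by (simp add: sketch_Z_def T_def V_def W_def Q_def N_def Let_def)
    then show ?thesis using to_mat_from_mat[of T] dT by (metis carrier_matI)
  qed
  show "A ** sketch_Z A M S = 0" "transpose (sketch_Z A M S) = sketch_Z A M S"
    "sketch_Z A M S ** M ** sketch_Z A M S = sketch_Z A M S"
    unfolding to_mat_eq_iff[symmetric] to_mat_mult to_mat_transpose Z to_mat_zero
    using AT Tsym TNT N_def by auto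
qed

locale sketch_distribution = prob_space D for D :: "real mat measure" +
  fixes A :: "real^'n^'m" and M :: "real^'n^'n"
  assumes M_sym: "transpose M = M" and M_psd: "\<And>u. 0 \<le> u \<bullet> (M *v u)"
    and sketch_rows: "space D \<subseteq> {T. dim_row T = CARD('n)}"
    and sketch_integrable: "integrable D (sketch_Z A M)"
    and mean_pos_def: "pos_def_on (null_space A) (sketch_mean A M D)"
begin

abbreviation "\<Z> \<equiv> sketch_Z A M"
abbreviation "Z \<equiv> sketch_mean A M D"
abbreviation "Zd \<equiv> mp_inv Z"

lemma sketch_null_space: "T \<in> space D \<Longrightarrow> \<Z> T *v u \<in> null_space A"
  using sketch_Z_algebra(1)[of T M A] sketch_rows M_sym
  by (auto simp: null_space_def matrix_vector_mul_assoc)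

lemma sketch_symmetric: "T \<in> space D \<Longrightarrow> (\<Z> T *v u) \<bullet> w = u \<bullet> (\<Z> T *v w)"
  using sketch_Z_algebra(2)[of T M A] sketch_rows M_sym by (intro symmetric_inner) auto

text \<open>Turns the quadratic term of the smoothness bound into the linear one, which yields the
  factor 1/2 in the descent.\<close>
lemma sketch_energy: "T \<in> space D \<Longrightarrow> (\<Z> T *v u) \<bullet> (M *v (\<Z> T *v u)) = u \<bullet> (\<Z> T *v u)"
  using sketch_Z_algebra(3)[of T M A] sketch_rows M_sym
  by (subst sketch_symmetric) (auto simp: matrix_vector_mul_assoc matrix_mul_assoc)

text \<open>\<open>Z_S\<close> is symmetric with range in the null space.\<close>
lemma sketch_orthogonal:
  assumes "T \<in> space D" "\<And>w. w \<in> null_space A \<Longrightarrow> w \<bullet> q = 0"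
  shows "\<Z> T *v q = 0"
proof -
  have "(\<Z> T *v q) \<bullet> (\<Z> T *v q) = (\<Z> T *v (\<Z> T *v q)) \<bullet> q"
    by (metis assms(1) sketch_symmetric)
  also have "\<dots> = 0" using assms sketch_null_space by blast
  finally show ?thesis by simp
qed

lemma integrable_sketch_apply: "integrable D (\<lambda>T. \<Z> T *v u)"
  by (rule integrable_bounded_linear[OF bounded_linear_apply_left sketch_integrable])

lemma integral_sketch_apply: "(\<integral>T. \<Z> T *v u \<partial>D) = Z *v u"
  using integral_bounded_linear[OF bounded_linear_apply_left sketch_integrable]
  by (simp add: sketch_mean_def)

lemma mean_transpose: "transpose Z = Z"
proof -
  have "transpose Z = (\<integral>T. transpose (\<Z> T) \<partial>D)"
    unfolding sketch_mean_def
    by (rule integral_bounded_linear[OF bounded_linear_transpose sketch_integrable, symmetric])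
  also have "\<dots> = Z" unfolding sketch_mean_def
    using sketch_Z_algebra(2)[of _ M A] sketch_rows M_sym by (intro Bochner_Integration.integral_cong) auto
  finally show ?thesis .
qed

lemmas mean_symmetric = symmetric_inner[OF mean_transpose]
lemmas mean_inv_symmetric = symmetric_inner[OF mp_inv_symmetric[OF mean_transpose]]

lemma mean_inner: "u \<bullet> (Z *v w) = (\<integral>T. u \<bullet> (\<Z> T *v w) \<partial>D)"
  by (subst integral_inner_right) (simp_all add: integrable_sketch_apply integral_sketch_apply)

lemma mean_psd: "0 \<le> u \<bullet> (Z *v u)"
  unfolding mean_inner
  by (intro integral_nonneg_AE AE_I2) (metis M_psd sketch_energy)

lemma mean_null_space: "Z *v u \<in> null_space A"
proof -
  have "A *v (Z *v u) = (\<integral>T. A *v (\<Z> T *v u) \<partial>D)"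
    unfolding integral_sketch_apply[symmetric]
    by (rule integral_bounded_linear[OF _ integrable_sketch_apply, symmetric]) simp
  also have "\<dots> = (\<integral>T. 0 \<partial>D)"
    using sketch_null_space by (intro Bochner_Integration.integral_cong) (auto simp: null_space_def)
  finally show ?thesis by (simp add: null_space_def)
qed

lemma mean_orthogonal:
  assumes "\<And>w. w \<in> null_space A \<Longrightarrow> w \<bullet> q = 0"
  shows "Z *v q = 0"
proof -
  have "(Z *v q) \<bullet> (Z *v q) = q \<bullet> (Z *v (Z *v q))" by (rule mean_symmetric)
  also have "\<dots> = 0" using assms[OF mean_null_space, of "Z *v q"] by (simp add: inner_commute)
  finally show ?thesis by simp
qed

text \<open>Only the component of \<open>u\<close> in the null space contributes to \<open>\<langle>u, Z u\<rangle>\<close>, and there \<open>Z\<close>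
  is definite.\<close>
lemma mean_eq_zero_orthogonal:
  assumes "u \<bullet> (Z *v u) = 0" "w \<in> null_space A"
  shows "w \<bullet> u = 0"
proof -
  obtain p q where pq: "u = p + q" "p \<in> null_space A" "\<And>w. w \<in> null_space A \<Longrightarrow> w \<bullet> q = 0"
    using null_space_decomp by blast
  have "Z *v q = 0" using pq mean_orthogonal by blast
  then have "u \<bullet> (Z *v u) = p \<bullet> (Z *v p)"
    using mean_symmetric[of q p] by (simp add: pq(1) matrix_vector_right_distrib inner_add_left)
  then have "p = 0" using assms(1) mean_pos_def pq(2) unfolding pos_def_on_def by force
  then show ?thesis using pq assms(2) by simp
qed

text \<open>\<open>Z\<^sup>\<dagger> Z\<close> acts as the orthogonal projection onto the null space: \<open>Z\<close> kills
  \<open>Z\<^sup>\<dagger> Z u - u\<close>, which is therefore orthogonal to the null space.\<close>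
lemma mean_inv_mean:
  assumes "w \<in> null_space A"
  shows "w \<bullet> (Zd *v (Z *v u)) = w \<bullet> u"
proof -
  let ?q = "Zd *v (Z *v u) - u"
  have "Z *v ?q = 0"
    using mp_inv_penrose(1)[of Z]
    by (simp add: matrix_vector_mult_diff_distrib matrix_vector_mul_assoc matrix_mul_assoc)
  then have "w \<bullet> ?q = 0" using mean_eq_zero_orthogonal[OF _ assms, of ?q] by simp
  then show ?thesis by (simp add: inner_diff_right)
qed

lemma mean_inv_energy: "u \<bullet> (Zd *v u) = (Zd *v u) \<bullet> (Z *v (Zd *v u))"
proof -
  have "Zd *v u = Zd *v (Z *v (Zd *v u))"
    using mp_inv_penrose(2)[of Z] by (simp add: matrix_vector_mul_assoc matrix_mul_assoc)
  then show ?thesis by (metis mean_inv_symmetric)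
qed

lemma mean_inv_psd: "0 \<le> u \<bullet> (Zd *v u)"
  unfolding mean_inv_energy by (rule mean_psd)

text \<open>From \<open>\<langle>w, Z\<^sup>\<dagger> w\<rangle> = 0\<close> it follows that \<open>Z Z\<^sup>\<dagger> w = 0\<close>; by symmetry \<open>w\<close> is then
  orthogonal to every \<open>Z\<^sup>\<dagger> Z v\<close>, which for \<open>w\<close> in the null space means orthogonal to every
  \<open>v\<close>.\<close>
lemma mean_inv_definite:
  assumes "w \<in> null_space A" "w \<bullet> (Zd *v w) = 0"
  shows "w = 0"
proof -
  have "v \<bullet> w = 0" for v
  proof -
    have "Z *v (Zd *v w) = 0"
      using mean_eq_zero_orthogonal[of "Zd *v w"] assms(2) mean_orthogonal unfolding mean_inv_energy[of w] by blast
    then have "(Z *v (Zd *v w)) \<bullet> v = 0" by simp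
    then have "w \<bullet> (Zd *v (Z *v v)) = 0" by (simp add: mean_symmetric mean_inv_symmetric)
    then show ?thesis using mean_inv_mean[OF assms(1)] by (simp add: inner_commute)
  qed
  then show ?thesis using inner_eq_zero_iff by blast
qed

lemma wnorm_mean_inv: "(wnorm Zd u)\<^sup>2 = u \<bullet> (Zd *v u)"
  by (simp add: wnorm_def mean_inv_psd)

lemma wnorm_mean: "(wnorm Z u)\<^sup>2 = u \<bullet> (Z *v u)"
  by (simp add: wnorm_def mean_psd)

lemma measurable_sketch [measurable]: "\<Z> \<in> borel_measurable D"
  using sketch_integrable by (rule borel_measurable_integrable)

text \<open>Definiteness of \<open>Z\<close> makes the denominator in \<open>\<nu>\<^sub>max\<close> positive, so the quotient can be
  cleared.\<close>
lemma second_moment_null_space: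
  assumes nu: "nu_max A M D \<le> ennreal \<nu>" and u: "u \<in> null_space A" "u \<noteq> 0"
  shows "(\<integral>\<^sup>+T. ennreal ((\<Z> T *v u) \<bullet> (Zd *v (\<Z> T *v u))) \<partial>D) \<le> ennreal \<nu> * ennreal (u \<bullet> (Z *v u))"
proof -
  let ?I = "\<integral>\<^sup>+T. ennreal ((\<Z> T *v u) \<bullet> (Zd *v (\<Z> T *v u))) \<partial>D"
  have pos: "0 < u \<bullet> (Z *v u)" using mean_pos_def u unfolding pos_def_on_def by blast
  have "?I / ennreal (u \<bullet> (Z *v u)) \<le> nu_max A M D"
    unfolding nu_max_def Let_def wnorm_mean_inv wnorm_mean using u by (intro SUP_upper2[of u]) auto
  then have "?I / ennreal (u \<bullet> (Z *v u)) \<le> ennreal \<nu>" using nu by simp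
  then have "?I / ennreal (u \<bullet> (Z *v u)) * ennreal (u \<bullet> (Z *v u)) \<le> ennreal \<nu> * ennreal (u \<bullet> (Z *v u))"
    by (rule mult_right_mono) simp
  then show ?thesis using pos by (subst (asm) ennreal_divide_times) (simp add: ennreal_times_divide mult_divide_eq_ennreal)
qed

text \<open>If \<open>\<nu>\<close> were not positive, the second moment at a nonzero \<open>u\<close> in the null space would
  vanish. Then \<open>Z_S u = 0\<close> almost surely, so \<open>Z u = 0\<close>, against definiteness. The dimension
  hypothesis provides \<open>u\<close>.\<close>
lemma moment_bound_positive:
  assumes "CARD('m) < CARD('n)" and nu: "nu_max A M D \<le> ennreal \<nu>"
  shows "0 < \<nu>"
proof (rule ccontr)
  assume "\<not> 0 < \<nu>"
  have "rank A \<noteq> CARD('n)" using rank_bound[of A] assms(1) by linarith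
  then obtain u where u: "u \<noteq> 0" "u \<in> null_space A"
    using matrix_nonfull_linear_equations_eq[of A] by (auto simp: null_space_def)
  have "(\<integral>\<^sup>+T. ennreal ((\<Z> T *v u) \<bullet> (Zd *v (\<Z> T *v u))) \<partial>D) \<le> 0"
    using second_moment_null_space[OF nu u(2,1)] \<open>\<not> 0 < \<nu>\<close> by (simp add: ennreal_neg)
  moreover have "(\<lambda>T. ennreal ((\<Z> T *v u) \<bullet> (Zd *v (\<Z> T *v u)))) \<in> borel_measurable D"
    using borel_measurable_integrable[OF integrable_sketch_apply[of u]] 
      borel_measurable_integrable[OF integrable_bounded_linear[OF matrix_vector_mul_bounded_linear integrable_sketch_apply[of u], of Zd]]
    by measurable
  ultimately have "AE T in D. ennreal ((\<Z> T *v u) \<bullet> (Zd *v (\<Z> T *v u))) = 0"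
    by (simp add: nn_integral_0_iff_AE)
  then have "AE T in D. \<Z> T *v u = 0"
    using AE_space
  proof eventually_elim
    case (elim T)
    then show ?case
      using mean_inv_definite[OF sketch_null_space, of T u] mean_inv_psd[of "\<Z> T *v u"] by simp
  qed
  then have "Z *v u = 0"
    unfolding integral_sketch_apply[symmetric] by (rule integral_eq_zero_AE)
  then show False using mean_pos_def u unfolding pos_def_on_def by force
qed

text \<open>The supremum in \<open>\<nu>\<^sub>max\<close> ranges over the null space only, but both sides depend only on
  the component of \<open>u\<close> there, so the bound extends to gradients, which are arbitrary
  vectors.\<close>
lemma second_moment:
  assumes nu: "nu_max A M D \<le> ennreal \<nu>" "0 < \<nu>"
  shows "integrable D (\<lambda>T. (\<Z> T *v u) \<bullet> (Zd *v (\<Z> T *v u)))" (is "integrable D ?h")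
    and "(\<integral>T. (\<Z> T *v u) \<bullet> (Zd *v (\<Z> T *v u)) \<partial>D) \<le> \<nu> * (u \<bullet> (Z *v u))"
proof -
  obtain p q where pq: "u = p + q" "p \<in> null_space A" "\<And>w. w \<in> null_space A \<Longrightarrow> w \<bullet> q = 0"
    using null_space_decomp by blast
  have Zp: "Z *v u = Z *v p"
    using mean_orthogonal[of q] pq(3) by (simp add: pq(1) matrix_vector_right_distrib)
  have Sp: "\<Z> T *v u = \<Z> T *v p" if "T \<in> space D" for T
    using sketch_orthogonal[OF that, of q] pq(3) by (simp add: pq(1) matrix_vector_right_distrib)
  have en: "u \<bullet> (Z *v u) = p \<bullet> (Z *v p)"
  proof -
    have "q \<bullet> (Z *v p) = 0" using pq(3)[OF mean_null_space, of p] by (simp add: inner_commute)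
    then show ?thesis unfolding Zp by (simp add: pq(1) inner_add_left)
  qed
  have "(\<integral>\<^sup>+T. ennreal (?h T) \<partial>D)
      = (\<integral>\<^sup>+T. ennreal ((\<Z> T *v p) \<bullet> (Zd *v (\<Z> T *v p))) \<partial>D)"
    by (intro nn_integral_cong) (simp add: Sp)
  also have "\<dots> \<le> ennreal \<nu> * ennreal (p \<bullet> (Z *v p))"
    using second_moment_null_space[OF nu(1) pq(2)] by (cases "p = 0") auto
  also have "\<dots> = ennreal (\<nu> * (u \<bullet> (Z *v u)))"
    using nu(2) mean_psd by (simp add: en ennreal_mult)
  finally have le: "(\<integral>\<^sup>+T. ennreal (?h T) \<partial>D) \<le> ennreal (\<nu> * (u \<bullet> (Z *v u)))" .
  have m: "?h \<in> borel_measurable D"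
    using borel_measurable_integrable[OF integrable_sketch_apply[of u]]
      borel_measurable_integrable[OF integrable_bounded_linear[OF matrix_vector_mul_bounded_linear integrable_sketch_apply[of u], of Zd]]
    by measurable
  show int: "integrable D ?h"
    by (rule integrableI_nonneg[OF m]) (use le mean_inv_psd in \<open>auto simp: le_less_trans[OF _ ennreal_less_top]\<close>)
  show "(\<integral>T. ?h T \<partial>D) \<le> \<nu> * (u \<bullet> (Z *v u))"
    using le nu(2) mean_psd[of u] by (subst (asm) nn_integral_eq_integral[OF int]) (auto simp: mean_inv_psd)
qed

end

section \<open>Convex differentiable functions\<close>

lemma gradient_along_line:
  fixes f :: "'a::real_inner \<Rightarrow> real"
  assumes "GDERIV f x :> g"
  shows "((\<lambda>t. f (x + t *\<^sub>R u)) has_real_derivative u \<bullet> g) (at 0)"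
proof -
  have "((\<lambda>t. x + t *\<^sub>R u) has_derivative (\<lambda>t. t *\<^sub>R u)) (at 0)"
    by (auto intro!: derivative_eq_intros)
  moreover have "(f has_derivative (\<lambda>h. h \<bullet> g)) (at (x + 0 *\<^sub>R u))"
    using assms by (simp add: gderiv_def)
  ultimately have "((\<lambda>t. f (x + t *\<^sub>R u)) has_derivative (\<lambda>t. (t *\<^sub>R u) \<bullet> g)) (at 0)"
    by (rule has_derivative_compose)
  then show ?thesis
    by (rule has_derivative_imp_has_field_derivative) (simp add: mult.commute)
qed

text \<open>Reduction to the tangent inequality on the line through \<open>x\<close> and \<open>z\<close>.\<close>
lemma convex_gradient_inequality:
  fixes f :: "'a::real_inner \<Rightarrow> real"
  assumes f: "convex_on UNIV f" and g: "GDERIV f x :> g"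
  shows "f x + g \<bullet> (z - x) \<le> f z"
proof -
  let ?h = "\<lambda>t. f (x + t *\<^sub>R (z - x))"
  have "convex_on UNIV ?h"
  proof (rule convex_onI)
    fix t r s :: real assume t: "0 < t" "t < 1"
    have "x + ((1 - t) *\<^sub>R r + t *\<^sub>R s) *\<^sub>R (z - x)
        = (1 - t) *\<^sub>R (x + r *\<^sub>R (z - x)) + t *\<^sub>R (x + s *\<^sub>R (z - x))"
      by (simp add: algebra_simps)
    then show "?h ((1 - t) *\<^sub>R r + t *\<^sub>R s) \<le> (1 - t) * ?h r + t * ?h s"
      using convex_onD[OF f, of t] t by simp
  qed simp
  from convex_on_imp_above_tangent[OF this, of 0 1 "(z - x) \<bullet> g"] gradient_along_line[OF g, of "z - x"]
  show ?thesis by (simp add: inner_commute)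
qed

lemma gradient_orthogonal_at_minimum:
  fixes f :: "real^'n \<Rightarrow> real"
  assumes g: "GDERIV f x :> g" and min: "\<And>w. w \<in> null_space A \<Longrightarrow> f x \<le> f (x + w)"
    and u: "u \<in> null_space A"
  shows "u \<bullet> g = 0"
proof (rule DERIV_local_min[OF gradient_along_line[OF g, of u], of 1])
  show "\<forall>t. \<bar>0 - t\<bar> < 1 \<longrightarrow> f (x + 0 *\<^sub>R u) \<le> f (x + t *\<^sub>R u)"
    using min subspace_scale[OF subspace_null_space u] by simp
qed simp

text \<open>The directional derivatives are pointwise limits of difference quotients of the
  continuous function \<open>f\<close>.\<close>
lemma borel_measurable_gradient:
  fixes f :: "'a::euclidean_space \<Rightarrow> real"
  assumes g: "\<And>z. GDERIV f z :> g z"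
  shows "f \<in> borel_measurable borel" "g \<in> borel_measurable borel"
proof -
  have "continuous_on UNIV f"
    using g by (intro differentiable_imp_continuous_on) (auto simp: differentiable_on_def differentiable_def gderiv_def)
  then show f: "f \<in> borel_measurable borel" by (rule borel_measurable_continuous_onI)
  show "g \<in> borel_measurable borel"
    unfolding borel_measurable_euclidean_space[of g]
  proof
    fix u :: 'a
    show "(\<lambda>z. g z \<bullet> u) \<in> borel_measurable borel"
    proof (rule borel_measurable_LIMSEQ_real)
      fix z
      have "((\<lambda>h. (f (z + h *\<^sub>R u) - f z) / h) \<longlongrightarrow> u \<bullet> g z) (at 0)"
        using gradient_along_line[OF g, of z u] by (simp add: DERIV_def)
      moreover have "filterlim (\<lambda>n. inverse (real (Suc n))) (at 0) sequentially"
        using LIMSEQ_inverse_real_of_nat by (auto simp: filterlim_at)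
      ultimately show "(\<lambda>n. (f (z + inverse (real (Suc n)) *\<^sub>R u) - f z) / inverse (real (Suc n)))
          \<longlonglongrightarrow> g z \<bullet> u"
        by (simp only: inner_commute) (rule filterlim_compose)
    next
      fix n
      show "(\<lambda>z. (f (z + inverse (real (Suc n)) *\<^sub>R u) - f z) / inverse (real (Suc n)))
          \<in> borel_measurable borel"
        using f by measurable
    qed
  qed
qed

lemma borel_measurable_matrix_vector_mult:
  fixes W :: "'a \<Rightarrow> real^'n^'m"
  assumes "W \<in> borel_measurable N" "u \<in> borel_measurable N"
  shows "(\<lambda>\<omega>. W \<omega> *v u \<omega>) \<in> borel_measurable N"
  by (rule borel_measurable_continuous_Pair[OF assms])
    (auto simp: matrix_vector_mult_def intro!: continuous_intros)

section \<open>One step of the iteration\<close>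

text \<open>One iteration on the pair \<open>(x, v)\<close> with \<open>\<beta> = 1\<close>. Making the sketched preconditioner
  \<open>W\<close> an argument exhibits the iterates as a measurable function of finitely many samples.\<close>
definition arsd_step ::
  "(real^'n \<Rightarrow> real^'n) \<Rightarrow> real \<Rightarrow> real \<Rightarrow> real^'n^'n \<Rightarrow> (real^'n) \<times> (real^'n) \<Rightarrow> (real^'n) \<times> (real^'n)" where
  "arsd_step g a c W s = (let y = a *\<^sub>R snd s + (1 - a) *\<^sub>R fst s in
     (y - W *v g y, snd s - c *\<^sub>R (W *v g y)))"

primrec arsd_state ::
  "(real^'n \<Rightarrow> real^'n) \<Rightarrow> (nat \<Rightarrow> real) \<Rightarrow> (nat \<Rightarrow> real) \<Rightarrow> real^'n \<Rightarrow> (nat \<Rightarrow> real^'n^'n) \<Rightarrow> nat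
    \<Rightarrow> (real^'n) \<times> (real^'n)" where
  "arsd_state g a c x0 W 0 = (x0, x0)"
| "arsd_state g a c x0 W (Suc k) = arsd_step g (a k) (c k) (W k) (arsd_state g a c x0 W k)"

lemma arsd_run_state:
  assumes "arsd_run A M g x0 a b c S x y v" "\<And>k. b k = 1"
  shows "(x k, v k) = arsd_state g a c x0 (\<lambda>i. sketch_Z A M (S i)) k"
proof (induction k)
  case (Suc k)
  show ?case using assms
    by (simp add: Suc.IH[symmetric] arsd_run_def arsd_step_def Let_def)
qed (use assms in \<open>simp add: arsd_run_def\<close>)

lemma arsd_state_cong:
  assumes "\<And>i. i < k \<Longrightarrow> W i = W' i"
  shows "arsd_state g a c x0 W k = arsd_state g a c x0 W' k"
  using assms by (induction k) auto

lemma measurable_arsd_state: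
  fixes W :: "nat \<Rightarrow> 'a \<Rightarrow> real^'n^'n"
  assumes g: "g \<in> borel_measurable borel" and W: "\<And>i. i < k \<Longrightarrow> W i \<in> borel_measurable N"
  shows "(\<lambda>\<omega>. fst (arsd_state g a c x0 (\<lambda>i. W i \<omega>) k)) \<in> borel_measurable N \<and>
         (\<lambda>\<omega>. snd (arsd_state g a c x0 (\<lambda>i. W i \<omega>) k)) \<in> borel_measurable N"
  using W
proof (induction k)
  case (Suc k)
  let ?s = "\<lambda>\<omega>. arsd_state g a c x0 (\<lambda>i. W i \<omega>) k"
  have [measurable]: "(\<lambda>\<omega>. fst (?s \<omega>)) \<in> borel_measurable N" "(\<lambda>\<omega>. snd (?s \<omega>)) \<in> borel_measurable N"
    using Suc by auto
  have "(\<lambda>\<omega>. g (a k *\<^sub>R snd (?s \<omega>) + (1 - a k) *\<^sub>R fst (?s \<omega>))) \<in> borel_measurable N"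
    by (rule measurable_compose[OF _ g]) measurable
  then have [measurable]: "(\<lambda>\<omega>. W k \<omega> *v g (a k *\<^sub>R snd (?s \<omega>) + (1 - a k) *\<^sub>R fst (?s \<omega>))) \<in> borel_measurable N"
    using Suc.prems by (intro borel_measurable_matrix_vector_mult) auto
  show ?case by (simp add: arsd_step_def Let_def)
qed simp

locale sketched_descent = sketch_distribution D A M
  for D :: "real mat measure" and A :: "real^'n^'m" and M :: "real^'n^'n" +
  fixes f :: "real^'n \<Rightarrow> real" and g :: "real^'n \<Rightarrow> real^'n" and x0 :: "real^'n" and \<nu> :: real
  assumes gradient: "\<And>z. GDERIV f z :> g z" and convex: "convex_on UNIV f"
    and smooth: "\<And>z z'. z \<in> feasible A (A *v x0) \<Longrightarrow> z' \<in> feasible A (A *v x0) \<Longrightarrow>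
           f z' \<le> f z + g z \<bullet> (z' - z) + 1/2 * ((z' - z) \<bullet> (M *v (z' - z)))"
    and nu: "nu_max A M D \<le> ennreal \<nu>" and nu_pos: "0 < \<nu>"
begin

abbreviation "F \<equiv> feasible A (A *v x0)"

abbreviation energy :: "real^'n \<Rightarrow> real" where "energy u \<equiv> u \<bullet> (Zd *v u)"

text \<open>The coefficient \<open>c\<close> of the suboptimality is left open because it changes from step to
  step.\<close>
definition lyapunov :: "real^'n \<Rightarrow> real \<Rightarrow> (real^'n) \<times> (real^'n) \<Rightarrow> real" where
  "lyapunov xs c s = energy (snd s - xs) + 2 * c * (f (fst s) - f xs)"

lemma feasible_diff: "z \<in> F \<Longrightarrow> z' \<in> F \<Longrightarrow> z - z' \<in> null_space A"
  by (simp add: feasible_def null_space_def matrix_vector_mult_diff_distrib)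

lemma feasible_add: "z \<in> F \<Longrightarrow> w \<in> null_space A \<Longrightarrow> z - c *\<^sub>R w \<in> F"
  by (simp add: feasible_def null_space_def matrix_vector_mult_diff_distrib matrix_vector_mult_scaleR)

lemma feasible_average: "z \<in> F \<Longrightarrow> z' \<in> F \<Longrightarrow> a *\<^sub>R z + (1 - a) *\<^sub>R z' \<in> F"
  by (simp add: feasible_def matrix_vector_right_distrib matrix_vector_mult_scaleR
      scaleR_add_left[symmetric])

lemma descent:
  assumes T: "T \<in> space D" and y: "y \<in> F"
  shows "f (y - \<Z> T *v g y) \<le> f y - 1/2 * (g y \<bullet> (\<Z> T *v g y))"
proof -
  have "y - \<Z> T *v g y \<in> F" using feasible_add[OF y sketch_null_space[OF T], of 1] by simp
  from smooth[OF y this] show ?thesis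
    using sketch_energy[OF T, of "g y"] by (simp add: matrix_vector_mult_diff_distrib[of M 0, simplified])
qed

lemma arsd_step_feasible:
  assumes "T \<in> space D" "fst s \<in> F" "snd s \<in> F"
  shows "fst (arsd_step g a c (\<Z> T) s) \<in> F" "snd (arsd_step g a c (\<Z> T) s) \<in> F"
  using feasible_add[OF feasible_average[OF assms(3,2), of a] sketch_null_space[OF assms(1)], of 1]
    feasible_add[OF assms(3) sketch_null_space[OF assms(1)]]
  by (simp_all add: arsd_step_def Let_def)

lemma lyapunov_nonneg:
  assumes "\<And>z. z \<in> F \<Longrightarrow> f xs \<le> f z" "fst s \<in> F" "0 \<le> c"
  shows "0 \<le> lyapunov xs c s"
  using assms mean_inv_psd by (simp add: lyapunov_def)

lemma energy_diff: "energy (u - c *\<^sub>R d) = energy u - 2 * c * (d \<bullet> (Zd *v u)) + c\<^sup>2 * energy d"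
proof -
  have "u \<bullet> (Zd *v d) = d \<bullet> (Zd *v u)" by (metis mean_inv_symmetric inner_commute)
  then have "(u - c *\<^sub>R d) \<bullet> (Zd *v u - c *\<^sub>R (Zd *v d))
      = energy u - 2 * c * (d \<bullet> (Zd *v u)) + c\<^sup>2 * energy d"
    by (simp add: inner_diff_left inner_diff_right power2_eq_square right_diff_distrib)
  then show ?thesis by (simp add: matrix_vector_mult_diff_distrib matrix_vector_mult_scaleR)
qed

text \<open>Since \<open>a (v - xs) = (1 - a) (y - x) + a (y - xs)\<close>, convexity at \<open>y\<close> bounds the inner
  product below by function values. The factor \<open>c\<^sup>2 \<nu>\<close> is \<open>c / a\<close>, so clearing the
  denominator \<open>a\<close> makes \<open>f y\<close> appear with exactly the weight that the descent term
  produces.\<close>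
lemma coupling_inequality:
  assumes c: "0 < c" and a: "a = 1 / (c * \<nu>)" "a \<le> 1" and y: "y = a *\<^sub>R v + (1 - a) *\<^sub>R x"
  shows "c\<^sup>2 * \<nu> * (f y - f xs) - (c\<^sup>2 * \<nu> - c) * (f x - f xs) \<le> c * ((v - xs) \<bullet> g y)"
proof -
  have ca: "c\<^sup>2 * \<nu> * a = c" using c nu_pos by (simp add: a(1) power2_eq_square)
  have "a *\<^sub>R (v - xs) = (1 - a) *\<^sub>R (y - x) + a *\<^sub>R (y - xs)"
    by (simp add: y algebra_simps)
  then have eq: "a * ((v - xs) \<bullet> g y) = (1 - a) * ((y - x) \<bullet> g y) + a * ((y - xs) \<bullet> g y)"
    by (metis inner_add_left inner_scaleR_left)
  have 1: "f y - f z \<le> (y - z) \<bullet> g y" for z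
    using convex_gradient_inequality[OF convex gradient[of y], of z]
    by (simp add: inner_diff_left inner_diff_right inner_commute)
  have "0 < a" using c nu_pos by (simp add: a(1))
  then have "(1 - a) * (f y - f x) + a * (f y - f xs) \<le> a * ((v - xs) \<bullet> g y)"
    unfolding eq using a(2) 1 by (intro add_mono mult_left_mono) auto
  then have "c\<^sup>2 * \<nu> * ((1 - a) * (f y - f x) + a * (f y - f xs)) \<le> c\<^sup>2 * \<nu> * (a * ((v - xs) \<bullet> g y))"
    using nu_pos by (intro mult_left_mono) auto
  also have "c\<^sup>2 * \<nu> * (a * ((v - xs) \<bullet> g y)) = c * ((v - xs) \<bullet> g y)"
    by (subst ca[symmetric]) simp
  also have "c\<^sup>2 * \<nu> * ((1 - a) * (f y - f x) + a * (f y - f xs))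
      = c\<^sup>2 * \<nu> * (f y - f xs) - (c\<^sup>2 * \<nu> - c\<^sup>2 * \<nu> * a) * (f x - f xs)"
    by (simp add: algebra_simps)
  finally show ?thesis unfolding ca .
qed

text \<open>The new Lyapunov value is dominated by a function \<open>h\<close> of the sketch that is affine in
  \<open>Z_S g\<close> up to the squared norm of \<open>Z_S g\<close>, so its integral is known from the mean and the
  second moment. The gain from the descent then compensates the second moment exactly.\<close>
lemma expected_lyapunov_step:
  assumes xs: "xs \<in> F" "\<And>z. z \<in> F \<Longrightarrow> f xs \<le> f z" and s: "fst s \<in> F" "snd s \<in> F"
    and c: "0 < c" and a: "a = 1 / (c * \<nu>)" "a \<le> 1"
  shows "(\<integral>\<^sup>+T. ennreal (lyapunov xs (c\<^sup>2 * \<nu>) (arsd_step g a c (\<Z> T) s)) \<partial>D)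
    \<le> ennreal (lyapunov xs (c\<^sup>2 * \<nu> - c) s)"
proof -
  define x v where "x = fst s" and "v = snd s"
  define y where "y = a *\<^sub>R v + (1 - a) *\<^sub>R x"
  define d where "d = (\<lambda>T. \<Z> T *v g y)"
  have y: "y \<in> F" using feasible_average[OF s(2,1), of a] by (simp add: y_def x_def v_def)
  have vxs: "v - xs \<in> null_space A" using feasible_diff s(2) xs(1) by (simp add: v_def)
  (* The cross term and the squared norm come from energy_diff, the last term from the descent. *)
  define h where "h = (\<lambda>T. energy (v - xs) - 2 * c * (d T \<bullet> (Zd *v (v - xs))) + c\<^sup>2 * energy (d T)
     + 2 * (c\<^sup>2 * \<nu>) * (f y - f xs - 1/2 * (g y \<bullet> d T)))"
  have le: "lyapunov xs (c\<^sup>2 * \<nu>) (arsd_step g a c (\<Z> T) s) \<le> h T" if T: "T \<in> space D" for T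
  proof -
    have "energy (v - c *\<^sub>R d T - xs) = energy ((v - xs) - c *\<^sub>R d T)" by (simp add: algebra_simps)
    moreover have "2 * (c\<^sup>2 * \<nu>) * (f (y - d T) - f xs)
        \<le> 2 * (c\<^sup>2 * \<nu>) * (f y - f xs - 1/2 * (g y \<bullet> d T))"
      using descent[OF T y] nu_pos by (intro mult_left_mono) (auto simp: d_def)
    moreover have "arsd_step g a c (\<Z> T) s = (y - d T, v - c *\<^sub>R d T)"
      by (simp add: arsd_step_def Let_def y_def x_def v_def d_def)
    ultimately show ?thesis
      unfolding lyapunov_def h_def energy_diff by (simp only: fst_conv snd_conv energy_diff)
  qed
  have h_nonneg: "0 \<le> h T" if T: "T \<in> space D" for T
    using le[OF T] lyapunov_nonneg[OF xs(2) arsd_step_feasible(1)[OF T s], of "c\<^sup>2 * \<nu>" a c] nu_pos by simp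
  have int: "integrable D d" "(\<integral>T. d T \<partial>D) = Z *v g y"
    unfolding d_def using integrable_sketch_apply integral_sketch_apply by auto
  have int2: "integrable D (\<lambda>T. energy (d T))" "(\<integral>T. energy (d T) \<partial>D) \<le> \<nu> * (g y \<bullet> (Z *v g y))"
    unfolding d_def using second_moment[OF nu nu_pos] by auto
  have h_int: "integrable D h" unfolding h_def using int(1) int2(1) by auto
  have "(\<integral>T. h T \<partial>D) = energy (v - xs) - 2 * c * ((Z *v g y) \<bullet> (Zd *v (v - xs)))
      + c\<^sup>2 * (\<integral>T. energy (d T) \<partial>D) + 2 * (c\<^sup>2 * \<nu>) * (f y - f xs - 1/2 * (g y \<bullet> (Z *v g y)))"
    unfolding h_def using int(1) int2(1) by (simp add: int(2) prob_space)
  also have "(Z *v g y) \<bullet> (Zd *v (v - xs)) = (v - xs) \<bullet> g y"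
    using mean_inv_mean[OF vxs] mean_inv_symmetric by (metis inner_commute)
  finally have "(\<integral>T. h T \<partial>D) \<le> energy (v - xs) - 2 * (c * ((v - xs) \<bullet> g y))
      + c\<^sup>2 * (\<nu> * (g y \<bullet> (Z *v g y))) + 2 * (c\<^sup>2 * \<nu>) * (f y - f xs - 1/2 * (g y \<bullet> (Z *v g y)))"
    using mult_left_mono[OF int2(2), of "c\<^sup>2"] by simp
  also have "\<dots> = energy (v - xs) - 2 * (c * ((v - xs) \<bullet> g y)) + 2 * (c\<^sup>2 * \<nu> * (f y - f xs))"
    by (simp add: algebra_simps)
  also have "\<dots> \<le> lyapunov xs (c\<^sup>2 * \<nu> - c) s"
  proof -
    have "lyapunov xs (c\<^sup>2 * \<nu> - c) s = energy (v - xs) + 2 * ((c\<^sup>2 * \<nu> - c) * (f x - f xs))"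
      by (simp only: lyapunov_def x_def v_def mult.assoc)
    then show ?thesis using coupling_inequality[OF c a y_def, of xs] by linarith
  qed
  finally have h_le: "(\<integral>T. h T \<partial>D) \<le> lyapunov xs (c\<^sup>2 * \<nu> - c) s" .
  have "(\<integral>\<^sup>+T. ennreal (lyapunov xs (c\<^sup>2 * \<nu>) (arsd_step g a c (\<Z> T) s)) \<partial>D) \<le> (\<integral>\<^sup>+T. ennreal (h T) \<partial>D)"
    by (intro nn_integral_mono ennreal_leI le)
  also have "\<dots> = ennreal (\<integral>T. h T \<partial>D)"
    using h_nonneg by (intro nn_integral_eq_integral[OF h_int] AE_I2)
  also have "\<dots> \<le> ennreal (lyapunov xs (c\<^sup>2 * \<nu> - c) s)" by (rule ennreal_leI[OF h_le])
  finally show ?thesis .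
qed

end

section \<open>Step sizes\<close>

text \<open>The largest root is \<open>1 / (2 \<nu>) + sqrt (1 / (2 \<nu>)\<^sup>2 + \<gamma>\<^sub>k\<^sup>2)\<close>, which exceeds \<open>\<gamma>\<^sub>k\<close> by
  at least \<open>1 / (2 \<nu>)\<close>.\<close>
lemma step_size_recursion:
  fixes c :: "nat \<Rightarrow> real"
  assumes nu: "0 < \<nu>" and c0: "c 0 = 1 / \<nu>"
    and cS: "\<And>k. c (Suc k) = (GREATEST t. t\<^sup>2 - 1 / \<nu> * t = (c k)\<^sup>2)"
  shows "(c (Suc k))\<^sup>2 * \<nu> - c (Suc k) = (c k)\<^sup>2 * \<nu>"
    and "(real k + 2) / (2 * \<nu>) \<le> c k"
proof -
  have greatest: "(c (Suc k))\<^sup>2 - 1 / \<nu> * c (Suc k) = (c k)\<^sup>2 \<and> c k + 1 / (2 * \<nu>) \<le> c (Suc k)" for k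
  proof -
    define r where "r = sqrt ((1 / (2 * \<nu>))\<^sup>2 + (c k)\<^sup>2)"
    have r2: "r\<^sup>2 = (1 / (2 * \<nu>))\<^sup>2 + (c k)\<^sup>2" by (simp add: r_def)
    have sol: "t\<^sup>2 - 1 / \<nu> * t = (c k)\<^sup>2 \<longleftrightarrow> (t - 1 / (2 * \<nu>))\<^sup>2 = r\<^sup>2" for t
    proof -
      have "(t - 1 / (2 * \<nu>))\<^sup>2 = t\<^sup>2 - 1 / \<nu> * t + (1 / (2 * \<nu>))\<^sup>2" by (simp add: power2_diff)
      then show ?thesis unfolding r2 by auto
    qed
    have "c (Suc k) = 1 / (2 * \<nu>) + r"
      unfolding cS
    proof (rule Greatest_equality)
      show "(1 / (2 * \<nu>) + r)\<^sup>2 - 1 / \<nu> * (1 / (2 * \<nu>) + r) = (c k)\<^sup>2"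
        unfolding sol by simp
      fix t assume "t\<^sup>2 - 1 / \<nu> * t = (c k)\<^sup>2"
      then have "\<bar>t - 1 / (2 * \<nu>)\<bar> = \<bar>r\<bar>" unfolding sol by (simp add: power2_eq_iff abs_eq_iff)
      moreover have "0 \<le> r" by (simp add: r_def)
      ultimately show "t \<le> 1 / (2 * \<nu>) + r" by linarith
    qed
    moreover have "c k \<le> r" unfolding r_def by (rule real_le_rsqrt) simp
    ultimately show ?thesis unfolding sol by simp
  qed
  have "((c (Suc k))\<^sup>2 - 1 / \<nu> * c (Suc k)) * \<nu> = (c k)\<^sup>2 * \<nu>" using greatest[of k] by simp
  then show "(c (Suc k))\<^sup>2 * \<nu> - c (Suc k) = (c k)\<^sup>2 * \<nu>" using nu by (simp add: left_diff_distrib)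
  show "(real k + 2) / (2 * \<nu>) \<le> c k"
  proof (induction k)
    case (Suc k)
    have "(real (Suc k) + 2) / (2 * \<nu>) = (real k + 2) / (2 * \<nu>) + 1 / (2 * \<nu>)"
      by (simp add: add_divide_distrib)
    then show ?case using Suc greatest[of k] by linarith
  qed (simp add: c0)
qed

section \<open>Telescoping over independent sketches\<close>

context sketched_descent
begin

lemma measurable_f: "f \<in> borel_measurable borel" and measurable_g: "g \<in> borel_measurable borel"
  using borel_measurable_gradient[of f g] gradient by auto

lemma measurable_state:
  assumes "\<And>i. i < k \<Longrightarrow> i \<in> I"
  shows "(\<lambda>\<omega>. fst (arsd_state g a c x0 (\<lambda>i. \<Z> (\<omega> i)) k)) \<in> borel_measurable (Pi\<^sub>M I (\<lambda>_. D))"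
    "(\<lambda>\<omega>. snd (arsd_state g a c x0 (\<lambda>i. \<Z> (\<omega> i)) k)) \<in> borel_measurable (Pi\<^sub>M I (\<lambda>_. D))"
proof -
  have "(\<lambda>\<omega>. \<Z> (\<omega> i)) \<in> borel_measurable (Pi\<^sub>M I (\<lambda>_. D))" if "i < k" for i
    by (rule measurable_compose[OF _ measurable_sketch], rule measurable_component_singleton)
      (use assms that in auto)
  then show "(\<lambda>\<omega>. fst (arsd_state g a c x0 (\<lambda>i. \<Z> (\<omega> i)) k)) \<in> borel_measurable (Pi\<^sub>M I (\<lambda>_. D))"
    "(\<lambda>\<omega>. snd (arsd_state g a c x0 (\<lambda>i. \<Z> (\<omega> i)) k)) \<in> borel_measurable (Pi\<^sub>M I (\<lambda>_. D))"
    using measurable_arsd_state[OF measurable_g, of k "\<lambda>i \<omega>. \<Z> (\<omega> i)"] by auto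
qed

lemma measurable_lyapunov:
  assumes [measurable]: "(\<lambda>\<omega>. fst (s \<omega>)) \<in> borel_measurable N" "(\<lambda>\<omega>. snd (s \<omega>)) \<in> borel_measurable N"
  shows "(\<lambda>\<omega>. lyapunov xs c (s \<omega>)) \<in> borel_measurable N"
proof -
  have [measurable]: "(\<lambda>\<omega>. f (fst (s \<omega>))) \<in> borel_measurable N"
    by (rule measurable_compose[OF _ measurable_f]) measurable
  have [measurable]: "(\<lambda>\<omega>. Zd *v (snd (s \<omega>) - xs)) \<in> borel_measurable N"
    by (rule borel_measurable_matrix_vector_mult) measurable
  show ?thesis unfolding lyapunov_def by measurable
qed

lemma arsd_state_feasible:
  assumes "\<And>i. i < k \<Longrightarrow> \<omega> i \<in> space D"
  shows "fst (arsd_state g a c x0 (\<lambda>i. \<Z> (\<omega> i)) k) \<in> F \<and> snd (arsd_state g a c x0 (\<lambda>i. \<Z> (\<omega> i)) k) \<in> F"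
  using assms
proof (induction k)
  case 0
  then show ?case by (simp add: feasible_def)
next
  case (Suc k)
  then show ?case using arsd_step_feasible[of "\<omega> k" "arsd_state g a c x0 (\<lambda>i. \<Z> (\<omega> i)) k"] by simp
qed

text \<open>Induction on \<open>k\<close>: by Fubini the last sketch is integrated first, with the earlier ones
  fixed, and the hypothesis \<open>cS\<close> matches the coefficients of consecutive steps. At \<open>k = 0\<close>
  the coefficient vanishes because \<open>c 0 = 1 / \<nu>\<close>.\<close>
lemma expected_lyapunov:
  assumes xs: "xs \<in> F" "\<And>z. z \<in> F \<Longrightarrow> f xs \<le> f z"
    and c: "\<And>k. 0 < c k" and a: "\<And>k. a k = 1 / (c k * \<nu>)" "\<And>k. a k \<le> 1"
    and c0: "c 0 = 1 / \<nu>" and cS: "\<And>k. (c (Suc k))\<^sup>2 * \<nu> - c (Suc k) = (c k)\<^sup>2 * \<nu>"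
  shows "(\<integral>\<^sup>+\<omega>. ennreal (lyapunov xs ((c k)\<^sup>2 * \<nu> - c k) (arsd_state g a c x0 (\<lambda>i. \<Z> (\<omega> i)) k)) \<partial>Pi\<^sub>M {..<k} (\<lambda>_. D))
     \<le> ennreal (energy (x0 - xs))"
proof (induction k)
  case 0
  have "(c 0)\<^sup>2 * \<nu> - c 0 = 0" using nu_pos by (simp add: c0 power2_eq_square)
  moreover have "emeasure (Pi\<^sub>M {} (\<lambda>_::nat. D)) (space (Pi\<^sub>M {} (\<lambda>_. D))) = 1"
    by (intro prob_space.emeasure_space_1 prob_space_PiM prob_space_axioms)
  ultimately show ?case by (simp add: lyapunov_def)
next
  case (Suc k)
  interpret product_sigma_finite "\<lambda>_::nat. D"
    by (simp add: product_sigma_finite_def sigma_finite_measure_axioms)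
  let ?s = "\<lambda>k \<omega>. arsd_state g a c x0 (\<lambda>i. \<Z> (\<omega> i)) k"
  have "(\<integral>\<^sup>+\<omega>. ennreal (lyapunov xs ((c k)\<^sup>2 * \<nu>) (?s (Suc k) \<omega>)) \<partial>Pi\<^sub>M (insert k {..<k}) (\<lambda>_. D))
    = (\<integral>\<^sup>+\<omega>. (\<integral>\<^sup>+T. ennreal (lyapunov xs ((c k)\<^sup>2 * \<nu>) (?s (Suc k) (fun_upd \<omega> k T))) \<partial>D) \<partial>Pi\<^sub>M {..<k} (\<lambda>_. D))"
    by (rule product_nn_integral_insert; (rule measurable_compose[OF measurable_lyapunov measurable_ennreal];
        rule measurable_state)?) auto
  also have "\<dots> \<le> (\<integral>\<^sup>+\<omega>. ennreal (lyapunov xs ((c k)\<^sup>2 * \<nu> - c k) (?s k \<omega>)) \<partial>Pi\<^sub>M {..<k} (\<lambda>_. D))"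
  proof (rule nn_integral_mono)
    fix \<omega> assume "\<omega> \<in> space (Pi\<^sub>M {..<k} (\<lambda>_. D))"
    then have "\<omega> i \<in> space D" if "i < k" for i using that by (auto simp: space_PiM)
    then have feas: "fst (?s k \<omega>) \<in> F" "snd (?s k \<omega>) \<in> F" using arsd_state_feasible[of k \<omega>] by auto
    have "?s (Suc k) (fun_upd \<omega> k T) = arsd_step g (a k) (c k) (\<Z> T) (?s k \<omega>)" for T
      using arsd_state_cong[of k "\<lambda>i. \<Z> ((fun_upd \<omega> k T) i)" "\<lambda>i. \<Z> (\<omega> i)"] by simp
    then show "(\<integral>\<^sup>+T. ennreal (lyapunov xs ((c k)\<^sup>2 * \<nu>) (?s (Suc k) (fun_upd \<omega> k T))) \<partial>D)
        \<le> ennreal (lyapunov xs ((c k)\<^sup>2 * \<nu> - c k) (?s k \<omega>))"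
      using expected_lyapunov_step[OF xs feas c a(1) a(2)] by simp
  qed
  also note Suc
  finally show ?case by (simp only: cS lessThan_Suc)
qed

section \<open>The optimal set and the convergence rate\<close>

text \<open>A gradient in the row space is orthogonal to all feasible directions, so the tangent
  inequality at \<open>xs\<close> has no linear term on the feasible set.\<close>
lemma optimal_set_minimizes:
  assumes "xs \<in> opt_set A (A *v x0) g"
  shows "xs \<in> F" "\<And>z. z \<in> F \<Longrightarrow> f xs \<le> f z"
proof -
  show xs: "xs \<in> F" using assms by (simp add: opt_set_def)
  obtain w where w: "g xs = transpose A *v w" using assms by (auto simp: opt_set_def)
  fix z assume "z \<in> F"
  then have "A *v (z - xs) = 0" using feasible_diff xs by (simp add: null_space_def)
  then have "g xs \<bullet> (z - xs) = 0" by (simp add: w dot_lmul_matrix)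
  then show "f xs \<le> f z" using convex_gradient_inequality[OF convex gradient, of xs z] by simp
qed

text \<open>Together with the attained minimum this shows that the optimal set is nonempty, without
  which the infimum over it would be meaningless.\<close>
lemma minimizer_in_optimal_set:
  assumes z: "z \<in> F" and min: "\<And>z'. z' \<in> F \<Longrightarrow> f z \<le> f z'"
  shows "z \<in> opt_set A (A *v x0) g"
proof -
  have "f z \<le> f (z + w)" if "w \<in> null_space A" for w
    using min[OF feasible_add[OF z that, of "-1"]] by simp
  then have "w \<bullet> g z = 0" if "w \<in> null_space A" for w
    using gradient_orthogonal_at_minimum[OF gradient] that by blast
  then have "g z \<in> range (\<lambda>w. transpose A *v w)"
    by (rule orthogonal_null_space_imp_in_row_space)
  then show ?thesis using z unfolding opt_set_def by blast
qed

text \<open>Only the suboptimality part of the Lyapunov value is kept; for \<open>k = l + 1\<close> its weight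
  is \<open>2 (c l)\<^sup>2 \<nu> \<ge> (k + 1)\<^sup>2 / (2 \<nu>)\<close>.\<close>
lemma expected_suboptimality:
  assumes k: "1 \<le> k" and xs: "xs \<in> opt_set A (A *v x0) g"
    and a: "\<And>k. a k = 1 / (c k * \<nu>)" and c0: "c 0 = 1 / \<nu>"
    and cS: "\<And>k. c (Suc k) = (GREATEST t. t\<^sup>2 - 1 / \<nu> * t = (c k)\<^sup>2)"
    and P: "prob_space P" and S: "prob_space.indep_vars P (\<lambda>_. D) S UNIV" "\<And>k. distr P D (S k) = D"
    and x: "\<And>\<omega>. \<omega> \<in> space P \<Longrightarrow> x \<omega> = fst (arsd_state g a c x0 (\<lambda>i. \<Z> (S i \<omega>)) k)"
  shows "integrable P (\<lambda>\<omega>. f (x \<omega>) - f xs) \<and>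
    (\<integral>\<omega>. f (x \<omega>) - f xs \<partial>P) \<le> 2 * \<nu> / (real k + 1)\<^sup>2 * energy (x0 - xs)"
proof -
  interpret P: prob_space P by fact
  note opt = optimal_set_minimizes[OF xs]
  note c_rec = step_size_recursion[OF nu_pos c0 cS]
  have c_pos: "0 < c k" for k
  proof -
    have "0 < (real k + 2) / (2 * \<nu>)" using nu_pos by simp
    then show ?thesis using c_rec(2)[of k] by linarith
  qed
  have a_le: "a k \<le> 1" for k
  proof -
    have "2 / (2 * \<nu>) \<le> (real k + 2) / (2 * \<nu>)" using nu_pos by (intro divide_right_mono) auto
    then have "1 / \<nu> \<le> c k" using c_rec(2)[of k] by simp
    then show ?thesis using nu_pos c_pos[of k] by (simp add: a field_simps)
  qed
  obtain l where l: "k = Suc l" using k by (cases k) auto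
  let ?C = "(c l)\<^sup>2 * \<nu>"
  let ?L = "\<lambda>\<omega>. lyapunov xs ?C (arsd_state g a c x0 (\<lambda>i. \<Z> (\<omega> i)) k)"
  let ?X = "\<lambda>\<omega>. \<lambda>i\<in>{..<k}. S i \<omega>"
  have S_meas: "S i \<in> measurable P D" for i
    using S(1) unfolding P.indep_vars_def by auto
  have "P.indep_vars (\<lambda>_. D) S {..<k}" by (rule P.indep_vars_subset[OF S(1)]) simp
  then have distr: "distr P (Pi\<^sub>M {..<k} (\<lambda>_. D)) ?X = Pi\<^sub>M {..<k} (\<lambda>_. D)"
    using k S_meas by (subst (asm) P.indep_vars_iff_distr_eq_PiM) (auto simp: S(2) lessThan_empty_iff)
  have X_meas: "?X \<in> measurable P (Pi\<^sub>M {..<k} (\<lambda>_. D))"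
    using S_meas by (intro measurable_restrict) auto
  have state: "arsd_state g a c x0 (\<lambda>i. \<Z> (?X \<omega> i)) k = arsd_state g a c x0 (\<lambda>i. \<Z> (S i \<omega>)) k" for \<omega>
    by (rule arsd_state_cong) simp
  have x_feas: "x \<omega> \<in> F" if "\<omega> \<in> space P" for \<omega>
    using x[OF that] arsd_state_feasible[of k "\<lambda>i. S i \<omega>"] measurable_space[OF S_meas that] by simp
  have sub_nonneg: "0 \<le> f (x \<omega>) - f xs" if "\<omega> \<in> space P" for \<omega>
    using opt(2)[OF x_feas[OF that]] by simp
  have "x \<in> borel_measurable P"
  proof (subst measurable_cong[OF x])
    show "(\<lambda>\<omega>. fst (arsd_state g a c x0 (\<lambda>i. \<Z> (S i \<omega>)) k)) \<in> borel_measurable P"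
      using measurable_arsd_state[OF measurable_g, of k "\<lambda>i \<omega>. \<Z> (S i \<omega>)"]
        measurable_compose[OF S_meas measurable_sketch] by auto
  qed
  then have fx_meas: "(\<lambda>\<omega>. f (x \<omega>) - f xs) \<in> borel_measurable P"
    using measurable_compose[OF _ measurable_f] by measurable
  have C_pos: "0 < 2 * ?C" using c_pos[of l] nu_pos by simp
  have "(\<integral>\<^sup>+\<omega>. ennreal (2 * ?C * (f (x \<omega>) - f xs)) \<partial>P) \<le> (\<integral>\<^sup>+\<omega>. ennreal (?L (?X \<omega>)) \<partial>P)"
    unfolding state
    by (intro nn_integral_mono ennreal_leI) (simp add: lyapunov_def x mean_inv_psd)
  also have "\<dots> = (\<integral>\<^sup>+\<omega>. ennreal (?L \<omega>) \<partial>distr P (Pi\<^sub>M {..<k} (\<lambda>_. D)) ?X)"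
    by (rule nn_integral_distr[symmetric, OF X_meas],
        rule measurable_compose[OF measurable_lyapunov measurable_ennreal])
      (simp only: measurable_distr_eq1, rule measurable_state, simp)+
  also have "\<dots> \<le> ennreal (energy (x0 - xs))"
    unfolding distr using expected_lyapunov[OF opt c_pos a a_le c0 c_rec(1), of k] by (simp add: l c_rec(1))
  finally have bound: "(\<integral>\<^sup>+\<omega>. ennreal (2 * ?C * (f (x \<omega>) - f xs)) \<partial>P) \<le> ennreal (energy (x0 - xs))" .
  have "integrable P (\<lambda>\<omega>. 2 * ?C * (f (x \<omega>) - f xs))"
  proof (rule integrableI_nonneg)
    show "(\<lambda>\<omega>. 2 * ?C * (f (x \<omega>) - f xs)) \<in> borel_measurable P" using fx_meas by measurable
    show "AE \<omega> in P. 0 \<le> 2 * ?C * (f (x \<omega>) - f xs)"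
      using sub_nonneg nu_pos by (intro AE_I2 mult_nonneg_nonneg) auto
    show "(\<integral>\<^sup>+\<omega>. ennreal (2 * ?C * (f (x \<omega>) - f xs)) \<partial>P) < \<infinity>"
      using bound by (rule le_less_trans) simp
  qed
  then have "2 * ?C = 0 \<or> integrable P (\<lambda>\<omega>. f (x \<omega>) - f xs)" by (simp only: integrable_mult_left_iff)
  then have int: "integrable P (\<lambda>\<omega>. f (x \<omega>) - f xs)" using C_pos by (metis less_irrefl)
  have "2 * ?C * (\<integral>\<omega>. f (x \<omega>) - f xs \<partial>P) \<le> energy (x0 - xs)"
  proof -
    have "(\<integral>\<^sup>+\<omega>. ennreal (2 * ?C * (f (x \<omega>) - f xs)) \<partial>P) = ennreal (\<integral>\<omega>. 2 * ?C * (f (x \<omega>) - f xs) \<partial>P)"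
      using int sub_nonneg nu_pos by (intro nn_integral_eq_integral AE_I2 mult_nonneg_nonneg) auto
    then show ?thesis using bound mean_inv_psd by simp
  qed
  moreover have "(real k + 1)\<^sup>2 / (2 * \<nu>) \<le> 2 * ?C"
  proof -
    have "((real l + 2) / (2 * \<nu>))\<^sup>2 \<le> (c l)\<^sup>2" using c_rec(2)[of l] nu_pos by (intro power_mono) auto
    then have "2 * \<nu> * ((real l + 2) / (2 * \<nu>))\<^sup>2 \<le> 2 * \<nu> * (c l)\<^sup>2" using nu_pos by simp
    moreover have "(real k + 1)\<^sup>2 / (2 * \<nu>) = 2 * \<nu> * ((real l + 2) / (2 * \<nu>))\<^sup>2"
      using nu_pos by (simp add: l power_divide power2_eq_square add.commute)
    ultimately show ?thesis by (simp only: mult_ac)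
  qed
  moreover have "0 \<le> (\<integral>\<omega>. f (x \<omega>) - f xs \<partial>P)"
    using sub_nonneg by (intro integral_nonneg_AE AE_I2)
  ultimately have "(real k + 1)\<^sup>2 / (2 * \<nu>) * (\<integral>\<omega>. f (x \<omega>) - f xs \<partial>P) \<le> energy (x0 - xs)"
    by (meson mult_right_mono order_trans)
  then show ?thesis using int nu_pos by (simp add: field_simps)
qed

end

theorem theorem4p4:
  fixes f :: "real^'n \<Rightarrow> real" and grad_f :: "real^'n \<Rightarrow> real^'n"
    and A :: "real^'n^'m" and b :: "real^'m" and x0 :: "real^'n"
    and M Z :: "real^'n^'n" and D :: "real mat measure"
    and \<nu> :: real and \<alpha> \<beta> \<gamma> :: "nat \<Rightarrow> real"
    and P :: "'w measure" and S :: "nat \<Rightarrow> 'w \<Rightarrow> real mat"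
    and x y v :: "nat \<Rightarrow> 'w \<Rightarrow> real^'n"
  assumes "CARD('m) < CARD('n)"
    and "\<And>z. GDERIV f z :> grad_f z"
    and "convex_on UNIV f"
    and "x0 \<in> feasible A b"
    and "\<exists>z\<in>feasible A b. \<forall>z'\<in>feasible A b. f z \<le> f z'"
    \<comment> \<open>smoothness\<close>
    and "transpose M = M" and "\<And>u. 0 \<le> u \<bullet> (M *v u)" and "pos_def_on (null_space A) M"
    and "\<And>z z'. z \<in> (+) x0 ` null_space A \<Longrightarrow> z' \<in> (+) x0 ` null_space A \<Longrightarrow>
           f z' \<le> f z + grad_f z \<bullet> (z' - z) + 1/2 * ((z' - z) \<bullet> (M *v (z' - z)))"
    \<comment> \<open>sampling\<close>
    and "prob_space D" and "space D \<subseteq> {T. dim_row T = CARD('n)}"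
    and "integrable D (sketch_Z A M)"
    and "Z = sketch_mean A M D" and "pos_def_on (null_space A) Z"
    \<comment> \<open>parameters\<close>
    and "nu_max A M D \<le> ennreal \<nu>"
    and "\<gamma> 0 = 1 / \<nu>"
    and "\<And>k. \<gamma> (Suc k) = (GREATEST t. t\<^sup>2 - 1 / \<nu> * t = (\<gamma> k)\<^sup>2)"
    and "\<And>k. \<alpha> k = 1 / (\<gamma> k * \<nu>)"
    and "\<And>k. \<beta> k = 1"
    \<comment> \<open>independent samples from D, and the A-RSD iterates\<close>
    and "prob_space P"
    and "prob_space.indep_vars P (\<lambda>_. D) S UNIV"
    and "\<And>k. distr P D (S k) = D"
    and "\<And>\<omega>. \<omega> \<in> space P \<Longrightarrow> arsd_run A M grad_f x0 \<alpha> \<beta> \<gamma> (\<lambda>k. S k \<omega>)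
           (\<lambda>k. x k \<omega>) (\<lambda>k. y k \<omega>) (\<lambda>k. v k \<omega>)"
  shows "\<forall>k\<ge>1. integrable P (\<lambda>\<omega>. f (x k \<omega>) - (INF z\<in>feasible A b. f z)) \<and>
           (\<integral>\<omega>. f (x k \<omega>) - (INF z\<in>feasible A b. f z) \<partial>P)
             \<le> 2 * \<nu> / (real k + 1)\<^sup>2 *
                (INF xs\<in>opt_set A b grad_f. (wnorm (mp_inv Z) (x0 - xs))\<^sup>2)"
proof -
  have b: "b = A *v x0" using assms(4) by (simp add: feasible_def)
  have aff: "(+) x0 ` null_space A = feasible A b"
  proof
    show "(+) x0 ` null_space A \<subseteq> feasible A b"
      by (auto simp: b feasible_def null_space_def matrix_vector_right_distrib)
    show "feasible A b \<subseteq> (+) x0 ` null_space A"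
    proof
      fix z assume "z \<in> feasible A b"
      then have "z - x0 \<in> null_space A" "z = x0 + (z - x0)"
        by (simp_all add: b feasible_def null_space_def matrix_vector_mult_diff_distrib)
      then show "z \<in> (+) x0 ` null_space A" by blast
    qed
  qed
  interpret D: prob_space D by fact
  interpret Q: sketch_distribution D A M
    by unfold_locales (use assms in auto)
  interpret R: sketched_descent D A M f grad_f x0 \<nu>
    by unfold_locales (use assms(2,3,9,15) Q.moment_bound_positive[OF assms(1,15)] aff b in auto)
  obtain z where z: "z \<in> feasible A b" "\<And>z'. z' \<in> feasible A b \<Longrightarrow> f z \<le> f z'"
    using assms(5) by blast
  have z_opt: "z \<in> opt_set A b grad_f" using R.minimizer_in_optimal_set[of z] z b by blast
  have f_star: "(INF z\<in>feasible A b. f z) = f xs" if "xs \<in> opt_set A b grad_f" for xs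
    using R.optimal_set_minimizes[of xs] that b by (intro cInf_eq_minimum) auto
  have state: "x k \<omega> = fst (arsd_state grad_f \<alpha> \<gamma> x0 (\<lambda>i. sketch_Z A M (S i \<omega>)) k)"
    if "\<omega> \<in> space P" for k \<omega>
    using arsd_run_state[OF assms(23)[OF that] assms(19), of k] by (metis fst_conv)
  let ?E = "\<lambda>k. \<integral>\<omega>. f (x k \<omega>) - (INF z\<in>feasible A b. f z) \<partial>P"
  have bound: "integrable P (\<lambda>\<omega>. f (x k \<omega>) - (INF z\<in>feasible A b. f z)) \<and>
      ?E k \<le> 2 * \<nu> / (real k + 1)\<^sup>2 * (wnorm (mp_inv Z) (x0 - xs))\<^sup>2"
    if "1 \<le> k" "xs \<in> opt_set A b grad_f" for k xs
    unfolding f_star[OF that(2)] assms(13) Q.wnorm_mean_inv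
    using R.expected_suboptimality[OF that(1) _ assms(18,16,17,20,21,22) state] that(2) b by blast
  show ?thesis
  proof (intro allI impI conjI)
    fix k :: nat assume k: "1 \<le> k"
    show "integrable P (\<lambda>\<omega>. f (x k \<omega>) - (INF z\<in>feasible A b. f z))" using bound[OF k z_opt] by blast
    let ?c = "2 * \<nu> / (real k + 1)\<^sup>2"
    have c: "0 < ?c" using R.nu_pos by simp
    have "?E k / ?c \<le> (INF xs\<in>opt_set A b grad_f. (wnorm (mp_inv Z) (x0 - xs))\<^sup>2)"
    proof (rule cINF_greatest)
      show "opt_set A b grad_f \<noteq> {}" using z_opt by blast
      fix xs assume "xs \<in> opt_set A b grad_f"
      from bound[OF k this] show "?E k / ?c \<le> (wnorm (mp_inv Z) (x0 - xs))\<^sup>2"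
        by (simp only: pos_divide_le_eq[OF c]) (simp add: mult.commute)
    qed
    then have "?E k \<le> (INF xs\<in>opt_set A b grad_f. (wnorm (mp_inv Z) (x0 - xs))\<^sup>2) * ?c"
      by (simp only: pos_divide_le_eq[OF c])
    then show "?E k \<le> ?c * (INF xs\<in>opt_set A b grad_f. (wnorm (mp_inv Z) (x0 - xs))\<^sup>2)"
      by (simp only: mult.commute)
  qed
qed

end
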